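(* (i) Let $\bar p=(p(1),p(2),\dots)$ be a sequence with $0\le p(i)<1$ for all $i$ and $$\frac{\log\left(\prod_{i=1}^n (1-p(i))\right)}{\log n}\longrightarrow 0\quad\text{as } n\to\infty.$$ Then for every first order sentence $\psi$ from $L$ a zero-one law holds, i.e. $\lim_{n\to\infty}\mathrm{Prob}(n,\bar p;\psi)$ exists and equals $0$ or $1$. (ii) For every constant $\epsilon>0$ there exist a sequence $\bar p=(p(1),p(2),\dots)$ with $0\le p(i)\le 1$ and a first order sentence $\psi$ from $L$ such that $$-\frac{\log\left(\prod_{i=1}^n (1-p(i))\right)}{\log n}<\epsilon\quad\text{for all sufficiently large } n,$$ but $\liminf_{n\to\infty}\mathrm{Prob}(n,\bar p;\psi)=0$ while $\limsup_{n\to\infty}\mathrm{Prob}(n,\bar p;\psi)=1$.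
   Context: For a sequence $\bar p=(p(1),p(2),\dots)$ with $0\le p(i)\le 1$, $G(n,\bar p)$ is the random graph with vertex set $[n]=\{1,\dots,n\}$ in which each pair of distinct vertices $v,w$ is an edge with probability $p(|v-w|)$, independently for each pair. $L$ is the first order language of graphs: first order logic with equality whose only other predicate is the binary adjacency predicate. $\mathrm{Prob}(n,\bar p;\psi)$ denotes the probability that $G(n,\bar p)$ satisfies the sentence $\psi$. *)

theory Defs
  imports "HOL-Probability.Probability"
begin

text \<open>First order formulas over equality and a binary adjacency predicate; variables are named
  by natural numbers.\<close>

datatype formula =
    Eq nat nat
  | Adj nat nat
  | Neg formula
  | Conj formula formula
  | Exists nat formula

primrec free_vars :: "formula \<Rightarrow> nat set" where
  "free_vars (Eq x y) = {x, y}"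
| "free_vars (Adj x y) = {x, y}"
| "free_vars (Neg \<phi>) = free_vars \<phi>"
| "free_vars (Conj \<phi> \<psi>) = free_vars \<phi> \<union> free_vars \<psi>"
| "free_vars (Exists x \<phi>) = free_vars \<phi> - {x}"

definition sentence :: "formula \<Rightarrow> bool" where
  "sentence \<phi> \<longleftrightarrow> free_vars \<phi> = {}"

text \<open>A simple graph is given by a vertex set \<open>V\<close> and a set \<open>E\<close> of two-element subsets of \<open>V\<close>.\<close>

primrec sat :: "'v set \<Rightarrow> 'v set set \<Rightarrow> (nat \<Rightarrow> 'v) \<Rightarrow> formula \<Rightarrow> bool" where
  "sat V E \<rho> (Eq x y) \<longleftrightarrow> \<rho> x = \<rho> y"
| "sat V E \<rho> (Adj x y) \<longleftrightarrow> {\<rho> x, \<rho> y} \<in> E"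
| "sat V E \<rho> (Neg \<phi>) \<longleftrightarrow> \<not> sat V E \<rho> \<phi>"
| "sat V E \<rho> (Conj \<phi> \<psi>) \<longleftrightarrow> sat V E \<rho> \<phi> \<and> sat V E \<rho> \<psi>"
| "sat V E \<rho> (Exists x \<phi>) \<longleftrightarrow> (\<exists>v\<in>V. sat V E (\<rho>(x := v)) \<phi>)"

text \<open>For a sentence the truth value does not depend on the assignment, so quantifying over all
  assignments (not only those into \<open>V\<close>, of which there are none if \<open>V\<close> is empty) is
  harmless.\<close>

definition models :: "'v set \<Rightarrow> 'v set set \<Rightarrow> formula \<Rightarrow> bool" where
  "models V E \<psi> \<longleftrightarrow> (\<forall>\<rho>. sat V E \<rho> \<psi>)"

definition vertex_pairs :: "nat \<Rightarrow> nat set set" where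
  "vertex_pairs n = {e. e \<subseteq> {1..n} \<and> card e = 2}"

text \<open>The distribution of the edge set of \<open>G(n, p)\<close>. For \<open>e = {v, w}\<close> with \<open>v \<noteq> w\<close>, the number
  \<open>Max e - Min e\<close> is \<open>\<bar>v - w\<bar>\<close>. The value \<open>p 0\<close> is never used: sequences are indexed from 1.\<close>

definition random_graph :: "nat \<Rightarrow> (nat \<Rightarrow> real) \<Rightarrow> nat set set pmf" where
  "random_graph n p =
     map_pmf (\<lambda>c. {e. c e})
       (Pi_pmf (vertex_pairs n) False (\<lambda>e. bernoulli_pmf (p (Max e - Min e))))"

definition Prob :: "nat \<Rightarrow> (nat \<Rightarrow> real) \<Rightarrow> formula \<Rightarrow> real" where
  "Prob n p \<psi> = measure_pmf.prob (random_graph n p) {E. models {1..n} E \<psi>}"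

lemma sat_cong_free_vars:
  "(\<And>x. x \<in> free_vars \<phi> \<Longrightarrow> \<rho> x = \<sigma> x) \<Longrightarrow> sat V E \<rho> \<phi> = sat V E \<sigma> \<phi>"
proof (induction \<phi> arbitrary: \<rho> \<sigma>)
  case (Neg \<phi>)
  then show ?case by (metis free_vars.simps(3) sat.simps(3))
next
  case (Conj \<phi> \<psi>)
  then show ?case by (metis Un_iff free_vars.simps(4) sat.simps(4))
next
  case (Exists x \<phi>)
  have "sat V E (\<rho>(x := v)) \<phi> = sat V E (\<sigma>(x := v)) \<phi>" for v
    using Exists.prems by (intro Exists.IH) auto
  then show ?case by simp
qed auto

lemma models_sentence_iff: "sentence \<psi> \<Longrightarrow> models V E \<psi> \<longleftrightarrow> sat V E \<rho> \<psi>"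
  unfolding models_def sentence_def using sat_cong_free_vars[of \<psi>] by blast

end

theory Submission
  imports Defs "HOL-Real_Asymp.Real_Asymp"
begin

text \<open>
  Zero-one law. The product of the \<open>1 - p d\<close> over \<open>d \<le> n\<close> is \<open>n\<close> to a power that tends to \<open>0\<close>, so a
  block of \<open>M\<close> consecutive vertices is joined to nothing outside it with a probability that
  decays more slowly than any fixed negative power of \<open>n\<close>, while there are about \<open>n / M\<close> disjoint
  blocks to try. A second moment computation turns this into \<open>isolated_copy_tendsto\<close>: every graph
  \<open>H\<close> on \<open>{1..M}\<close> of positive probability sits, with probability tending to \<open>1\<close>, on some block as
  a union of connected components.

  Apply this to a well chosen \<open>H\<close>. Up to \<open>k\<close> rounds of the Ehrenfeucht--Fraisse game there are
  only finitely many graphs, and a disjoint union is insensitive to how often a summand occurs once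
  it occurs \<open>k\<close> times (\<open>ef_families\<close>). Hence, writing \<open>+\<close> for juxtaposition, the graph \<open>H\<close> made of
  \<open>k\<close> copies of one representative of each type of positive probability satisfies \<open>H + G \<equiv> H\<close> for
  every graph \<open>G\<close> of positive probability (\<open>absorbing_exists\<close>). If \<open>G\<close> itself splits as a copy
  of \<open>H\<close> and a remainder \<open>W\<close>, then \<open>W\<close> does not live on an interval and need not be absorbed,
  but \<open>G = H + W \<equiv> (H + H) + W = H + G \<equiv> H\<close>, which is \<open>absorbing_isolated_copy\<close>. So almost every
  \<open>G\<close> satisfies the same sentences of quantifier depth \<open>k\<close> as the fixed graph \<open>H\<close>.

  Oscillation. Let the distances below a constant \<open>K\<close> have probability \<open>1 / 2\<close>, and let rapidly
  growing distances \<open>s 0, s 1, \<dots>\<close> have probability \<open>1 - (s j) powr - \<delta>\<close>; all others have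
  probability \<open>0\<close>. The sentence says that some \<open>K\<close>-clique is joined to nothing else. Because the
  \<open>s j\<close> grow so fast, such a clique must consist of \<open>K\<close> consecutive vertices. On \<open>s j\<close> vertices the
  distance \<open>s j\<close> cannot occur, and if \<open>s j\<close> is large compared with the earlier terms the first part
  of the argument makes the sentence likely. On \<open>2 * s j\<close> vertices every vertex has a partner at
  distance \<open>s j\<close>, so a given block is isolated with probability at most \<open>(s j) powr (- \<delta> * K)\<close>,
  and for \<open>\<delta> * K \<ge> 2\<close> the union bound over the blocks tends to \<open>0\<close>. The price is small: each jump
  costs a factor \<open>(s j) powr - \<delta>\<close> in the product, and if \<open>(s j)\<^sup>2 \<le> s (j + 1)\<close> then all jumps up
  to \<open>n\<close> together cost at most a factor \<open>n powr (- 2 * \<delta>)\<close>.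
\<close>

section \<open>The Ehrenfeucht--Fraisse game\<close>

primrec qdepth :: "formula \<Rightarrow> nat" where
  "qdepth (Eq x y) = 0"
| "qdepth (Adj x y) = 0"
| "qdepth (Neg \<phi>) = qdepth \<phi>"
| "qdepth (Conj \<phi> \<psi>) = max (qdepth \<phi>) (qdepth \<psi>)"
| "qdepth (Exists x \<phi>) = Suc (qdepth \<phi>)"

definition partial_iso :: "'a set set \<Rightarrow> 'b set set \<Rightarrow> ('a \<times> 'b) set \<Rightarrow> bool" where
  "partial_iso E F R \<longleftrightarrow> (\<forall>a a' b b'. (a, a') \<in> R \<longrightarrow> (b, b') \<in> R \<longrightarrow>
     (a = b \<longleftrightarrow> a' = b') \<and> ({a, b} \<in> E \<longleftrightarrow> {a', b'} \<in> F))"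

text \<open>The position of a game is the set \<open>R\<close> of all pairs of vertices chosen so far; forgetting the order
  of the moves makes it possible to restrict, compose and unite positions as relations. The set \<open>E\<close>
  may contain edges outside \<open>V\<close>, so the same edge set serves for all induced subgraphs.\<close>

primrec ef :: "nat \<Rightarrow> 'a set \<Rightarrow> 'a set set \<Rightarrow> 'b set \<Rightarrow> 'b set set \<Rightarrow> ('a \<times> 'b) set \<Rightarrow> bool" where
  "ef 0 V E W F R \<longleftrightarrow> partial_iso E F R"
| "ef (Suc k) V E W F R \<longleftrightarrow> partial_iso E F R \<and>
     (\<forall>v\<in>V. \<exists>w\<in>W. ef k V E W F (insert (v, w) R)) \<and>
     (\<forall>w\<in>W. \<exists>v\<in>V. ef k V E W F (insert (v, w) R))"

lemma partial_iso_empty [simp]: "partial_iso E F {}"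
  by (simp add: partial_iso_def)

lemma ef_partial_iso: "ef k V E W F R \<Longrightarrow> partial_iso E F R"
  by (cases k) auto

lemma ef_Suc_imp: "ef (Suc k) V E W F R \<Longrightarrow> ef k V E W F R"
proof (induction k arbitrary: R)
  case (Suc k)
  show ?case
    unfolding ef.simps(2)[of k]
    using Suc.prems Suc.IH unfolding ef.simps(2)[of "Suc k"] by blast
qed simp

lemma partial_iso_subset: "R \<subseteq> S \<Longrightarrow> partial_iso E F S \<Longrightarrow> partial_iso E F R"
  unfolding partial_iso_def by blast

lemma ef_subset: "R \<subseteq> S \<Longrightarrow> ef k V E W F S \<Longrightarrow> ef k V E W F R"
proof (induction k arbitrary: R S)
  case 0
  then show ?case by (auto intro: partial_iso_subset)
next
  case (Suc k)
  have ins: "insert x R \<subseteq> insert x S" for x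
    using Suc.prems by blast
  show ?case
    using Suc.prems partial_iso_subset[OF Suc.prems(1)] Suc.IH[OF ins] by fastforce
qed

lemma ef_sym: "ef k V E W F R \<Longrightarrow> ef k W F V E (R\<inverse>)"
proof (induction k arbitrary: R)
  case 0
  then show ?case by (auto simp: partial_iso_def)
next
  case (Suc k)
  have conv: "insert (w, v) (R\<inverse>) = (insert (v, w) R)\<inverse>" for v w
    by auto
  have "partial_iso F E (R\<inverse>)"
    using Suc.prems by (auto simp: partial_iso_def)
  then show ?case
    using Suc.prems Suc.IH unfolding ef.simps conv by blast
qed

lemma partial_iso_trans:
  assumes "partial_iso E F R" "partial_iso F G S"
  shows "partial_iso E G (R O S)"
  unfolding partial_iso_def
proof (intro allI impI)
  fix a c b d assume "(a, c) \<in> R O S" "(b, d) \<in> R O S"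
  then obtain x y where "(a, x) \<in> R" "(x, c) \<in> S" "(b, y) \<in> R" "(y, d) \<in> S"
    by blast
  then have "(a = b) = (x = y) \<and> ({a, b} \<in> E) = ({x, y} \<in> F)"
    "(x = y) = (c = d) \<and> ({x, y} \<in> F) = ({c, d} \<in> G)"
    using assms unfolding partial_iso_def by blast+
  then show "(a = b) = (c = d) \<and> ({a, b} \<in> E) = ({c, d} \<in> G)"
    by simp
qed

lemma ef_trans:
  "ef k V E W F R \<Longrightarrow> ef k W F X G S \<Longrightarrow> ef k V E X G (R O S)"
proof (induction k arbitrary: R S)
  case 0
  then show ?case by (simp add: partial_iso_trans)
next
  case (Suc k)
  have sub: "insert (v, x) (R O S) \<subseteq> insert (v, w) R O insert (w, x) S" for v w x
    by blast
  have step: "ef k V E X G (insert (v, x) (R O S))"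
    if "ef k V E W F (insert (v, w) R)" "ef k W F X G (insert (w, x) S)" for v w x
    using Suc.IH[OF that] ef_subset[OF sub] by blast
  have "partial_iso E G (R O S)"
    using Suc.prems by (intro partial_iso_trans) (auto dest: ef_partial_iso)
  then show ?case
    using Suc.prems step unfolding ef.simps by meson
qed

lemma ef_empty_sym: "ef k V E W F {} \<Longrightarrow> ef k W F V E {}"
  using ef_sym[of k V E W F "{}"] by simp

lemma ef_empty_trans [trans]:
  "ef k V E W F {} \<Longrightarrow> ef k W F X G {} \<Longrightarrow> ef k V E X G {}"
  using ef_trans[of k V E W F "{}" X G "{}"] by simp

text \<open>Duplicator copies every move along the isomorphism \<open>f\<close>.\<close>

lemma ef_isomorphism:
  assumes inj: "inj_on f V"
    and edge: "\<And>a b. a \<in> V \<Longrightarrow> b \<in> V \<Longrightarrow> {a, b} \<in> E \<longleftrightarrow> {f a, f b} \<in> F"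
  shows "R \<subseteq> (\<lambda>v. (v, f v)) ` V \<Longrightarrow> ef k V E (f ` V) F R"
proof (induction k arbitrary: R)
  case 0
  have "a \<in> V \<and> a' = f a" if "(a, a') \<in> R" for a a'
    using 0 that by auto
  then show ?case
    using inj edge by (simp add: partial_iso_def) (metis inj_onD)
next
  case (Suc k)
  have "a \<in> V \<and> a' = f a" if "(a, a') \<in> R" for a a'
    using Suc.prems that by auto
  then have "partial_iso E F R"
    using inj edge by (simp add: partial_iso_def) (metis inj_onD)
  moreover have "ef k V E (f ` V) F (insert (v, f v) R)" if "v \<in> V" for v
    using Suc that by auto
  ultimately show ?case by auto
qed

lemma ef_same_edges:
  assumes "\<And>a b. a \<in> V \<Longrightarrow> b \<in> V \<Longrightarrow> {a, b} \<in> E \<longleftrightarrow> {a, b} \<in> F"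
  shows "ef k V E V F {}"
  using ef_isomorphism[of id V E F "{}" k] assms by simp

text \<open>The purpose of the game: a winning strategy for \<open>k\<close> rounds transfers formulas of quantifier
  depth \<open>k\<close>, a move being the choice of a witness.\<close>

lemma ef_sat_iff:
  assumes "ef k V E W F R" "qdepth \<phi> \<le> k" "\<And>x. x \<in> free_vars \<phi> \<Longrightarrow> (\<rho> x, \<sigma> x) \<in> R"
  shows "sat V E \<rho> \<phi> \<longleftrightarrow> sat W F \<sigma> \<phi>"
  using assms
proof (induction \<phi> arbitrary: k R \<rho> \<sigma>)
  case (Eq x y)
  then show ?case using ef_partial_iso[OF Eq.prems(1)] by (simp add: partial_iso_def)
next
  case (Adj x y)
  then show ?case using ef_partial_iso[OF Adj.prems(1)] by (simp add: partial_iso_def)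
next
  case (Neg \<phi>)
  then show ?case by (metis free_vars.simps(3) qdepth.simps(3) sat.simps(3))
next
  case (Conj \<phi> \<psi>)
  have "sat V E \<rho> \<phi> \<longleftrightarrow> sat W F \<sigma> \<phi>"
    using Conj.prems(2,3) by (intro Conj.IH(1)[OF Conj.prems(1)]) auto
  moreover have "sat V E \<rho> \<psi> \<longleftrightarrow> sat W F \<sigma> \<psi>"
    using Conj.prems(2,3) by (intro Conj.IH(2)[OF Conj.prems(1)]) auto
  ultimately show ?case by simp
next
  case (Exists x \<phi>)
  from Exists.prems(2) obtain l where k: "k = Suc l" and l: "qdepth \<phi> \<le> l"
    by (cases k) auto
  have eq: "sat V E (\<rho>(x := v)) \<phi> \<longleftrightarrow> sat W F (\<sigma>(x := w)) \<phi>"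
    if "ef l V E W F (insert (v, w) R)" for v w
    using Exists.prems(3) by (intro Exists.IH[OF that l]) auto
  show ?case
    using Exists.prems(1) eq unfolding k ef.simps sat.simps by meson
qed

section \<open>Disjoint unions\<close>

definition separated :: "'a set set \<Rightarrow> 'a set \<Rightarrow> 'a set \<Rightarrow> bool" where
  "separated E A B \<longleftrightarrow> A \<inter> B = {} \<and> (\<forall>a\<in>A. \<forall>b\<in>B. {a, b} \<notin> E)"

lemma separated_sym: "separated E A B \<Longrightarrow> separated E B A"
  unfolding separated_def by (metis Int_commute insert_commute)

lemma separated_UN:
  "(\<And>i. i \<in> I \<Longrightarrow> separated E A (P i)) \<Longrightarrow> separated E A (\<Union>i\<in>I. P i)"
  unfolding separated_def by blast

lemma partial_iso_Un:
  assumes "partial_iso E F R" "partial_iso E F S"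
    and "R \<subseteq> V \<times> W" "S \<subseteq> V' \<times> W'" "separated E V V'" "separated F W W'"
  shows "partial_iso E F (R \<union> S)"
proof -
  have mixed: "a \<noteq> b \<and> a' \<noteq> b' \<and> {a, b} \<notin> E \<and> {a', b'} \<notin> F \<and> {b, a} \<notin> E \<and> {b', a'} \<notin> F"
    if "(a, a') \<in> R" "(b, b') \<in> S" for a a' b b'
  proof -
    have "a \<in> V" "a' \<in> W" "b \<in> V'" "b' \<in> W'" using that assms(3,4) by auto
    then show ?thesis
      using assms(5,6) unfolding separated_def by (auto simp: insert_commute)
  qed
  show ?thesis
    unfolding partial_iso_def
  proof (intro allI impI)
    fix a a' b b' assume *: "(a, a') \<in> R \<union> S" "(b, b') \<in> R \<union> S"
    show "(a = b) = (a' = b') \<and> ({a, b} \<in> E) = ({a', b'} \<in> F)"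
    proof (cases "(a, a') \<in> R")
      case True
      show ?thesis
      proof (cases "(b, b') \<in> R")
        case True
        then show ?thesis using assms(1) \<open>(a, a') \<in> R\<close> unfolding partial_iso_def by blast
      next
        case False
        then show ?thesis using mixed[OF \<open>(a, a') \<in> R\<close>, of b b'] * by blast
      qed
    next
      case False
      then have a: "(a, a') \<in> S" using * by blast
      show ?thesis
      proof (cases "(b, b') \<in> R")
        case True
        then show ?thesis using mixed[OF _ a, of b b'] by blast
      next
        case False
        then show ?thesis using assms(2) a * unfolding partial_iso_def by blast
      qed
    qed
  qed
qed

text \<open>Duplicator answers each move in the summand where it was made, by the strategy for that summand.
  As no edge runs between the summands, the union of the two positions is again a partial
  isomorphism.\<close>

lemma ef_Un:
  assumes "ef k V E W F R" "ef k V' E W' F S"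
    and "R \<subseteq> V \<times> W" "S \<subseteq> V' \<times> W'" "separated E V V'" "separated F W W'"
  shows "ef k (V \<union> V') E (W \<union> W') F (R \<union> S)"
  using assms(1-4)
proof (induction k arbitrary: R S)
  case 0
  then show ?case using partial_iso_Un[OF _ _ _ _ assms(5,6)] by simp
next
  case (Suc k)
  have iso: "partial_iso E F (R \<union> S)"
    using Suc.prems partial_iso_Un[OF _ _ _ _ assms(5,6)] by simp
  have left: "ef k (V \<union> V') E (W \<union> W') F (insert (v, w) (R \<union> S))"
    if "ef k V E W F (insert (v, w) R)" "v \<in> V" "w \<in> W" for v w
    using Suc.IH[OF that(1) ef_Suc_imp[OF Suc.prems(2)]] that Suc.prems(3,4) by simp
  have right: "ef k (V \<union> V') E (W \<union> W') F (insert (v, w) (R \<union> S))"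
    if "ef k V' E W' F (insert (v, w) S)" "v \<in> V'" "w \<in> W'" for v w
    using Suc.IH[OF ef_Suc_imp[OF Suc.prems(1)] that(1)] that Suc.prems(3,4) by simp
  have forth: "\<exists>w\<in>W \<union> W'. ef k (V \<union> V') E (W \<union> W') F (insert (v, w) (R \<union> S))"
    if v: "v \<in> V \<union> V'" for v
  proof (cases "v \<in> V")
    case True
    then show ?thesis using Suc.prems(1) left by fastforce
  next
    case False
    then show ?thesis using v Suc.prems(2) right by fastforce
  qed
  have backward: "\<exists>v\<in>V \<union> V'. ef k (V \<union> V') E (W \<union> W') F (insert (v, w) (R \<union> S))"
    if w: "w \<in> W \<union> W'" for w
  proof (cases "w \<in> W")
    case True
    then show ?thesis using Suc.prems(1) left by fastforce
  next
    case False
    then show ?thesis using w Suc.prems(2) right by fastforce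
  qed
  show ?case using iso forth backward by simp
qed

text \<open>Disjoint unions can be compared by counting summands of each type up to the threshold \<open>k\<close>. The
  colours \<open>c\<close> and \<open>d\<close> record types. A move falls into one summand; Duplicator picks a summand of the
  same colour on the other side and plays there. Both are then set aside, which lowers one
  count by one on each side, just as one round has been used up.\<close>

lemma ef_families:
  assumes "finite I" "finite J"
    and "\<And>i j. i \<in> I \<Longrightarrow> j \<in> J \<Longrightarrow> c i = d j \<Longrightarrow> ef k (P i) E (Q j) F {}"
    and "pairwise (\<lambda>i i'. separated E (P i) (P i')) I"
    and "pairwise (\<lambda>j j'. separated F (Q j) (Q j')) J"
    and "\<And>x. card {i \<in> I. c i = x} = card {j \<in> J. d j = x} \<or>
             k \<le> card {i \<in> I. c i = x} \<and> k \<le> card {j \<in> J. d j = x}"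
  shows "ef k (\<Union>i\<in>I. P i) E (\<Union>j\<in>J. Q j) F {}"
  using assms
proof (induction k arbitrary: I J)
  case 0
  then show ?case by simp
next
  case (Suc k)
  have step: "ef k (\<Union>i\<in>I. P i) E (\<Union>j\<in>J. Q j) F {(v, w)}"
    if i: "i \<in> I" and j: "j \<in> J" and col: "c i = d j" and v: "v \<in> P i" and w: "w \<in> Q j"
      and vw: "ef k (P i) E (Q j) F {(v, w)}" for i j v w
  proof -
    have less: "card {i' \<in> I - {i}. c i' = x} = card {i' \<in> I. c i' = x} - (if x = c i then 1 else 0)" for x
    proof (cases "x = c i")
      case True
      then have "{i' \<in> I - {i}. c i' = x} = {i' \<in> I. c i' = x} - {i}" by auto
      then show ?thesis using i True by simp
    next
      case False
      then have "{i' \<in> I - {i}. c i' = x} = {i' \<in> I. c i' = x}" by auto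
      then show ?thesis using False by simp
    qed
    have less': "card {j' \<in> J - {j}. d j' = x} = card {j' \<in> J. d j' = x} - (if x = c i then 1 else 0)" for x
    proof (cases "x = d j")
      case True
      then have "{j' \<in> J - {j}. d j' = x} = {j' \<in> J. d j' = x} - {j}" by auto
      then show ?thesis using j True col by simp
    next
      case False
      then have "{j' \<in> J - {j}. d j' = x} = {j' \<in> J. d j' = x}" by auto
      then show ?thesis using False col by simp
    qed
    have rest: "ef k (\<Union>i\<in>I - {i}. P i) E (\<Union>j\<in>J - {j}. Q j) F {}"
    proof (rule Suc.IH)
      fix x show "card {i' \<in> I - {i}. c i' = x} = card {j' \<in> J - {j}. d j' = x} \<or>
        k \<le> card {i' \<in> I - {i}. c i' = x} \<and> k \<le> card {j' \<in> J - {j}. d j' = x}"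
        unfolding less less' using Suc.prems(6)[of x] by auto
    next
      fix i' j' assume "i' \<in> I - {i}" "j' \<in> J - {j}" "c i' = d j'"
      then show "ef k (P i') E (Q j') F {}"
        by (intro ef_Suc_imp[OF Suc.prems(3)]) auto
    qed (use Suc.prems(1,2,4,5) in \<open>auto intro: pairwise_subset\<close>)
    have sep: "separated E (P i) (\<Union>i\<in>I - {i}. P i)" "separated F (Q j) (\<Union>j\<in>J - {j}. Q j)"
      using Suc.prems(4,5) i j by (auto intro!: separated_UN dest: pairwiseD)
    have "P i \<union> (\<Union>i\<in>I - {i}. P i) = (\<Union>i\<in>I. P i)" "Q j \<union> (\<Union>j\<in>J - {j}. Q j) = (\<Union>j\<in>J. Q j)"
      using i j by blast+
    moreover have "ef k (P i \<union> (\<Union>i\<in>I - {i}. P i)) E (Q j \<union> (\<Union>j\<in>J - {j}. Q j)) F ({(v, w)} \<union> {})"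
      using v w by (intro ef_Un[OF vw rest _ _ sep]) blast+
    ultimately show ?thesis by simp
  qed
  have partner1: "\<exists>j\<in>J. c i = d j" if "i \<in> I" for i
  proof -
    have "card {i' \<in> I. c i' = c i} > 0"
      using that Suc.prems(1) by (auto simp: card_gt_0_iff)
    then have "card {j \<in> J. d j = c i} > 0"
      using Suc.prems(6)[of "c i"] by auto
    then have "{j \<in> J. d j = c i} \<noteq> {}" by (auto simp: card_gt_0_iff)
    then show ?thesis by force
  qed
  have partner2: "\<exists>i\<in>I. c i = d j" if "j \<in> J" for j
  proof -
    have "card {j' \<in> J. d j' = d j} > 0"
      using that Suc.prems(2) by (auto simp: card_gt_0_iff)
    then have "card {i \<in> I. c i = d j} > 0"
      using Suc.prems(6)[of "d j"] by auto
    then show ?thesis by (auto simp: card_gt_0_iff)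
  qed
  have forth: "\<exists>w\<in>\<Union>j\<in>J. Q j. ef k (\<Union>i\<in>I. P i) E (\<Union>j\<in>J. Q j) F {(v, w)}"
    if "v \<in> (\<Union>i\<in>I. P i)" for v
  proof -
    from that obtain i where i: "i \<in> I" "v \<in> P i" by blast
    with partner1 obtain j where j: "j \<in> J" "c i = d j" by blast
    then obtain w where "w \<in> Q j" "ef k (P i) E (Q j) F {(v, w)}"
      using Suc.prems(3)[OF i(1) j] i by auto
    then show ?thesis using step[OF i(1) j i(2)] j by blast
  qed
  have backward: "\<exists>v\<in>\<Union>i\<in>I. P i. ef k (\<Union>i\<in>I. P i) E (\<Union>j\<in>J. Q j) F {(v, w)}"
    if "w \<in> (\<Union>j\<in>J. Q j)" for w
  proof -
    from that obtain j where j: "j \<in> J" "w \<in> Q j" by blast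
    with partner2 obtain i where i: "i \<in> I" "c i = d j" by blast
    then obtain v where "v \<in> P i" "ef k (P i) E (Q j) F {(v, w)}"
      using Suc.prems(3)[OF i(1) j(1) i(2)] j by auto
    then show ?thesis using step[OF i(1) j(1) i(2) _ j(2)] i by blast
  qed
  show ?case using forth backward by simp
qed

section \<open>Finitely many types\<close>

text \<open>Replaces an invariant of any type by a natural number, so that invariants built in successive
  rounds all have the same type.\<close>

lemma finite_range_nat_code:
  assumes "finite (range F)"
  obtains f :: "'a \<Rightarrow> nat" where "finite (range f)" "\<And>x y. f x = f y \<Longrightarrow> F x = F y"
proof
  show "finite (range (\<lambda>x. to_nat_on (range F) (F x)))"
    using assms by (metis finite_imageI image_image)
  fix x y assume "to_nat_on (range F) (F x) = to_nat_on (range F) (F y)"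
  then show "F x = F y"
    using inj_on_to_nat_on[OF countable_finite[OF assms]] by (auto dest: inj_onD)
qed

text \<open>A numerical invariant with finitely many values that decides the game with \<open>l\<close> chosen vertices
  and \<open>k\<close> rounds to go: for \<open>k = 0\<close> the diagram of the chosen vertices, and for \<open>k + 1\<close> the set of
  invariants, with \<open>k\<close> rounds to go, of all one-vertex extensions, together with that of the present
  position, which guarantees a partial isomorphism also when there is no vertex to choose.\<close>

lemma finitely_many_ef_types:
  "\<exists>f :: 'a set \<times> 'a set set \<times> 'a list \<Rightarrow> nat. finite (range f) \<and>
     (\<forall>V E xs W F ys. length xs = l \<longrightarrow> length ys = l \<longrightarrow> f (V, E, xs) = f (W, F, ys) \<longrightarrow>
        ef k V E W F (set (zip xs ys)))"
proof (induction k arbitrary: l)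
  case 0
  define D where "D = (\<lambda>(V :: 'a set, E :: 'a set set, xs :: 'a list).
    ({(i, j). i < l \<and> j < l \<and> xs ! i = xs ! j}, {(i, j). i < l \<and> j < l \<and> {xs ! i, xs ! j} \<in> E}))"
  have "range D \<subseteq> Pow ({..<l} \<times> {..<l}) \<times> Pow ({..<l} \<times> {..<l})"
    by (auto simp: D_def)
  then have "finite (range D)"
    by (rule finite_subset) auto
  then obtain f :: "_ \<Rightarrow> nat" where f: "finite (range f)" "\<And>x y. f x = f y \<Longrightarrow> D x = D y"
    using finite_range_nat_code[of D] by blast
  have "partial_iso E F (set (zip xs ys))"
    if "length xs = l" "length ys = l" "f (V, E, xs) = f (W, F, ys)" for V E xs W F ys
  proof -
    have eq: "D (V, E, xs) = D (W, F, ys)" using that f by blast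
    have "(xs ! i = xs ! j \<longleftrightarrow> ys ! i = ys ! j) \<and> ({xs ! i, xs ! j} \<in> E \<longleftrightarrow> {ys ! i, ys ! j} \<in> F)"
      if "i < l" "j < l" for i j
      using eq that unfolding D_def by (auto simp: set_eq_iff)
    then show ?thesis
      using that unfolding partial_iso_def set_zip by fastforce
  qed
  then show ?case using f(1) by (intro exI[of _ f]) simp
next
  case (Suc k)
  obtain g :: "'a set \<times> 'a set set \<times> 'a list \<Rightarrow> nat" where g: "finite (range g)"
    "\<And>V E xs W F ys. length xs = Suc l \<Longrightarrow> length ys = Suc l \<Longrightarrow> g (V, E, xs) = g (W, F, ys) \<Longrightarrow>
        ef k V E W F (set (zip xs ys))"
    using Suc[of "Suc l"] by blast
  obtain h :: "'a set \<times> 'a set set \<times> 'a list \<Rightarrow> nat" where h: "finite (range h)"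
    "\<And>V E xs W F ys. length xs = l \<Longrightarrow> length ys = l \<Longrightarrow> h (V, E, xs) = h (W, F, ys) \<Longrightarrow>
        ef k V E W F (set (zip xs ys))"
    using Suc[of l] by blast
  define D where "D = (\<lambda>(V, E, xs). (h (V, E, xs), (\<lambda>v. g (V, E, v # xs)) ` V))"
  have "range D \<subseteq> range h \<times> Pow (range g)"
    by (auto simp: D_def)
  then have "finite (range D)"
    by (rule finite_subset) (use g(1) h(1) in auto)
  then obtain f :: "_ \<Rightarrow> nat" where f: "finite (range f)" "\<And>x y. f x = f y \<Longrightarrow> D x = D y"
    using finite_range_nat_code[of D] by blast
  have "ef (Suc k) V E W F (set (zip xs ys))"
    if len: "length xs = l" "length ys = l" and eqf: "f (V, E, xs) = f (W, F, ys)" for V E xs W F ys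
  proof -
    have "D (V, E, xs) = D (W, F, ys)" using f eqf by blast
    then have eq: "h (V, E, xs) = h (W, F, ys)"
      "(\<lambda>v. g (V, E, v # xs)) ` V = (\<lambda>w. g (W, F, w # ys)) ` W"
      by (auto simp: D_def)
    have "partial_iso E F (set (zip xs ys))"
      using h(2)[OF len eq(1)] by (rule ef_partial_iso)
    moreover have "ef k V E W F (insert (v, w) (set (zip xs ys)))"
      if "g (V, E, v # xs) = g (W, F, w # ys)" for v w
      using g(2)[OF _ _ that] len by simp
    moreover have "\<exists>w\<in>W. g (V, E, v # xs) = g (W, F, w # ys)" if "v \<in> V" for v
      using eq(2) that by blast
    moreover have "\<exists>v\<in>V. g (V, E, v # xs) = g (W, F, w # ys)" if "w \<in> W" for w
      using eq(2)[symmetric] that by (metis (no_types, lifting) image_iff)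
    ultimately show ?thesis unfolding ef.simps by blast
  qed
  then show ?case using f(1) by (intro exI[of _ f]) simp
qed

lemma finite_ef_representatives:
  obtains C where "finite C" "C \<subseteq> \<G>"
    "\<And>W F. (W, F) \<in> \<G> \<Longrightarrow> \<exists>(V, E)\<in>C. ef k V E W F {}"
proof -
  obtain f :: "'a set \<times> 'a set set \<times> 'a list \<Rightarrow> nat" where f: "finite (range f)"
    "\<And>V E W F. f (V, E, []) = f (W, F, []) \<Longrightarrow> ef k V E W F {}"
    using finitely_many_ef_types[of 0 k] by auto
  define g where "g = (\<lambda>(V, E). f (V, E, []))"
  define r where "r = inv_into \<G> g"
  have "finite (g ` \<G>)"
    by (rule finite_subset[OF _ f(1)]) (auto simp: g_def)
  then have "finite (r ` g ` \<G>)" by simp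
  moreover have "r ` g ` \<G> \<subseteq> \<G>" by (auto simp: r_def inv_into_into)
  moreover have "\<exists>(V, E)\<in>r ` g ` \<G>. ef k V E W F {}" if "(W, F) \<in> \<G>" for W F
  proof -
    have "g (r (g (W, F))) = g (W, F)"
      using that unfolding r_def by (intro f_inv_into_f) auto
    then have "case r (g (W, F)) of (V, E) \<Rightarrow> ef k V E W F {}"
      using f(2) by (auto simp: g_def split: prod.splits)
    moreover have "r (g (W, F)) \<in> r ` g ` \<G>" using that by simp
    ultimately show ?thesis by (rule bexI)
  qed
  ultimately show thesis by (rule that)
qed

section \<open>Graphs on intervals that have positive probability\<close>

definition possible :: "(nat \<Rightarrow> real) \<Rightarrow> nat \<Rightarrow> nat set set \<Rightarrow> bool" where
  "possible p n E \<longleftrightarrow> E \<subseteq> vertex_pairs n \<and> (\<forall>e\<in>E. 0 < p (Max e - Min e))"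

definition shift :: "nat \<Rightarrow> nat set set \<Rightarrow> nat set set" where
  "shift a E = (\<lambda>e. (+) a ` e) ` E"

lemma shift_pair_iff [simp]: "{a + x, a + y} \<in> shift a E \<longleftrightarrow> {x, y} \<in> E"
proof -
  have "inj ((`) ((+) a))"
    by (intro injI) (simp add: inj_image_eq_iff)
  moreover have "{a + x, a + y} = (+) a ` {x, y}" by simp
  ultimately show ?thesis unfolding shift_def by (metis inj_image_mem_iff)
qed

lemma in_shift_bounds: "e \<in> shift a E \<Longrightarrow> E \<subseteq> vertex_pairs m \<Longrightarrow> x \<in> e \<Longrightarrow> a < x \<and> x \<le> a + m"
  unfolding shift_def vertex_pairs_def by fastforce

lemma vertex_pairs_pair_iff [simp]:
  "{x, y} \<in> vertex_pairs n \<longleftrightarrow> x \<noteq> y \<and> x \<in> {1..n} \<and> y \<in> {1..n}"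
  by (auto simp: vertex_pairs_def card_2_iff doubleton_eq_iff)

lemma vertex_pairs_mono: "m \<le> n \<Longrightarrow> vertex_pairs m \<subseteq> vertex_pairs n"
  by (auto simp: vertex_pairs_def)

lemma vertex_pairsE:
  assumes "e \<in> vertex_pairs n"
  obtains x y where "e = {x, y}" "x < y" "1 \<le> x" "y \<le> n"
proof -
  from assms obtain x y where "e = {x, y}" "x \<noteq> y" "e \<subseteq> {1..n}"
    by (auto simp: vertex_pairs_def card_2_iff)
  then show ?thesis
    using that[of x y] that[of y x] by (cases "x < y") (auto simp: insert_commute)
qed

lemma finite_vertex_pairs [simp]: "finite (vertex_pairs n)"
  by (rule finite_subset[of _ "Pow {1..n}"]) (auto simp: vertex_pairs_def)

lemma shift_vertex_pairs: "E \<subseteq> vertex_pairs m \<Longrightarrow> shift a E \<subseteq> vertex_pairs (a + m)"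
  by (fastforce simp: shift_def elim!: vertex_pairsE)

lemma length_translate:
  assumes "e \<in> vertex_pairs n"
  shows "Max ((+) a ` e) - Min ((+) a ` e) = Max e - Min e"
  using assms by (elim vertex_pairsE) simp

lemma possible_juxtapose:
  assumes "possible p M H" "possible p m E"
  shows "possible p (M + m) (H \<union> shift M E)"
proof -
  have "H \<union> shift M E \<subseteq> vertex_pairs (M + m)"
    using assms shift_vertex_pairs[of E m M] vertex_pairs_mono[of M "M + m"]
    by (auto simp: possible_def)
  moreover have "0 < p (Max e - Min e)" if "e \<in> shift M E" for e
    using that assms(2) length_translate[of _ m M] by (auto simp: shift_def possible_def)
  ultimately show ?thesis using assms(1) by (auto simp: possible_def)
qed

lemma pair_notin_shift:
  "E \<subseteq> vertex_pairs m \<Longrightarrow> x \<le> M \<Longrightarrow> {x, y} \<notin> shift M E"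
  using in_shift_bounds[of "{x, y}" M E m x] by auto

lemma pair_notin_low:
  "H \<subseteq> vertex_pairs M \<Longrightarrow> M < y \<Longrightarrow> {x, y} \<notin> H"
  using vertex_pairs_pair_iff[of x y M] by fastforce

lemma separated_juxtapose:
  assumes "H \<subseteq> vertex_pairs M" "E \<subseteq> vertex_pairs m" "A \<subseteq> {1..M}" "\<And>b. b \<in> B \<Longrightarrow> M < b"
  shows "separated (H \<union> shift M E) A B"
  unfolding separated_def
proof (intro conjI ballI)
  show "A \<inter> B = {}" using assms(3,4) by force
  fix a b assume "a \<in> A" "b \<in> B"
  then show "{a, b} \<notin> H \<union> shift M E"
    using assms pair_notin_low[of H M b a] pair_notin_shift[of E m a M b] by auto
qed

lemma ef_juxtapose_low:
  assumes "E \<subseteq> vertex_pairs m" "A \<subseteq> {1..M}"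
  shows "ef k A (H \<union> shift M E) A H {}"
  using assms pair_notin_shift[of E m _ M] by (intro ef_same_edges) auto

lemma ef_juxtapose_high:
  assumes "H \<subseteq> vertex_pairs M" "A \<subseteq> {1..m}"
  shows "ef k ((+) M ` A) (H \<union> shift M E) A E {}"
proof (rule ef_empty_sym, rule ef_isomorphism)
  fix a b assume ab: "a \<in> A" "b \<in> A"
  then have "{M + a, M + b} \<notin> H"
    using assms by (intro pair_notin_low[of H M]) auto
  then show "{a, b} \<in> E \<longleftrightarrow> {M + a, M + b} \<in> H \<union> shift M E" by simp
qed auto

lemma image_add_interval: "(+) M ` {1..m} = {M + 1..M + m :: nat}"
  by simp

section \<open>A graph that absorbs every possible graph\<close>

text \<open>Placing finitely many graphs of positive probability side by side on consecutive intervals gives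
  a graph of positive probability that contains all of them as separated pieces. Since \<open>p\<close> depends
  on distances only, translating a piece does not change the probabilities of its edges, and the
  pairs between different pieces stay empty.\<close>

lemma juxtapose_family:
  assumes "finite I" "\<And>i. i \<in> I \<Longrightarrow> possible p (m i) (F i)"
  shows "\<exists>M H P. possible p M H \<and> {1..M} = (\<Union>i\<in>I. P i) \<and>
    pairwise (\<lambda>i j. separated H (P i) (P j)) I \<and> (\<forall>i\<in>I. ef k (P i) H {1..m i} (F i) {})"
  using assms
proof (induction I rule: finite_induct)
  case empty
  show ?case by (intro exI[of _ 0] exI[of _ "{}"]) (simp add: possible_def)
next
  case (insert x I)
  then obtain M H P where IH: "possible p M H" "{1..M} = (\<Union>i\<in>I. P i)"
    "pairwise (\<lambda>i j. separated H (P i) (P j)) I" "\<And>i. i \<in> I \<Longrightarrow> ef k (P i) H {1..m i} (F i) {}"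
    by auto
  have px: "possible p (m x) (F x)" using insert.prems by simp
  have HM: "H \<subseteq> vertex_pairs M" and FM: "F x \<subseteq> vertex_pairs (m x)"
    using IH(1) px by (auto simp: possible_def)
  define G where "G = H \<union> shift M (F x)"
  define Q where "Q = P(x := (+) M ` {1..m x})"
  have Q: "Q i = P i" "P i \<subseteq> {1..M}" if "i \<in> I" for i
    using that insert.hyps(2) IH(2) by (auto simp: Q_def)
  have Qx: "Q x = (+) M ` {1..m x}" by (simp add: Q_def)
  have "possible p (M + m x) G"
    unfolding G_def by (rule possible_juxtapose[OF IH(1) px])
  moreover have "{1..M + m x} = (\<Union>i\<in>insert x I. Q i)"
  proof -
    have "(\<Union>i\<in>insert x I. Q i) = {M + 1..M + m x} \<union> {1..M}"
      using Q(1) unfolding IH(2) by (simp add: Qx add.commute)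
    then show ?thesis by auto
  qed
  moreover have "pairwise (\<lambda>i j. separated G (Q i) (Q j)) (insert x I)"
  proof -
    have x: "separated G (Q i) (Q x)" if "i \<in> I" for i
      unfolding G_def Q(1)[OF that] Qx
      by (rule separated_juxtapose[OF HM FM Q(2)[OF that]]) auto
    have "separated G (Q i) (Q j)" if "i \<in> I" "j \<in> I" "i \<noteq> j" for i j
    proof -
      have "separated H (P i) (P j)" using IH(3) that by (simp add: pairwise_def)
      moreover have "{a, b} \<notin> shift M (F x)" if "a \<in> P i" for a b
        using Q(2)[OF \<open>i \<in> I\<close>] that by (intro pair_notin_shift[OF FM]) auto
      ultimately show ?thesis
        unfolding Q(1)[OF that(1)] Q(1)[OF that(2)] by (auto simp: separated_def G_def)
    qed
    then show ?thesis using x x[THEN separated_sym] unfolding pairwise_insert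
      by (auto simp: pairwise_def)
  qed
  moreover have "ef k (Q i) G {1..m i} (F i) {}" if i: "i \<in> insert x I" for i
  proof (cases "i = x")
    case True
    show ?thesis
      unfolding G_def Qx True by (rule ef_juxtapose_high[OF HM order_refl])
  next
    case False
    then have "i \<in> I" using i by simp
    then show ?thesis
      unfolding G_def Q(1)[OF \<open>i \<in> I\<close>]
      using ef_empty_trans[OF ef_juxtapose_low[OF FM Q(2)] IH(4)] by blast
  qed
  ultimately show ?case by blast
qed

definition absorbing :: "nat \<Rightarrow> (nat \<Rightarrow> real) \<Rightarrow> nat \<Rightarrow> nat set set \<Rightarrow> bool" where
  "absorbing k p M H \<longleftrightarrow> possible p M H \<and>
     (\<forall>m E. possible p m E \<longrightarrow> ef k {1..M + m} (H \<union> shift M E) {1..M} H {})"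

text \<open>Take \<open>k\<close> copies of a representative of each \<open>k\<close>-type of positive probability. A further
  summand only raises one count that has already reached the threshold.\<close>

lemma absorbing_exists: "\<exists>M H. absorbing k p M H"
proof -
  define \<G> where "\<G> = {({1..m}, E) |m E. possible p m E}"
  obtain C where C: "finite C" "C \<subseteq> \<G>"
    "\<And>W F. (W, F) \<in> \<G> \<Longrightarrow> \<exists>(V, E)\<in>C. ef k V E W F {}"
    by (rule finite_ef_representatives[of \<G> k]) blast
  define I where "I = C \<times> {..<k}"
  have finI: "finite I" using C(1) by (simp add: I_def)
  have cardI: "card {i \<in> I. fst i = x} \<ge> k" if "x \<in> C" for x
  proof -
    have "{i \<in> I. fst i = x} = {x} \<times> {..<k}" using that by (auto simp: I_def)
    then show ?thesis by (simp add: card_cartesian_product)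
  qed
  have "\<exists>m E. i = ({1..m}, E) \<and> possible p m E" if "i \<in> C" for i
    using C(2) that by (auto simp: \<G>_def)
  then obtain m F where mF: "\<And>i. i \<in> C \<Longrightarrow> i = ({1..m i}, F i) \<and> possible p (m i) (F i)"
    by metis
  obtain M H P where H: "possible p M H" "{1..M} = (\<Union>i\<in>I. P i)"
    "pairwise (\<lambda>i j. separated H (P i) (P j)) I"
    "\<And>i. i \<in> I \<Longrightarrow> ef k (P i) H {1..m (fst i)} (F (fst i)) {}"
  proof -
    have "possible p ((m \<circ> fst) i) ((F \<circ> fst) i)" if "i \<in> I" for i
      using mF[of "fst i"] that by (auto simp: I_def)
    from juxtapose_family[OF finI, of p "m \<circ> fst" "F \<circ> fst" k, OF this]
    obtain M H P where "possible p M H" "{1..M} = (\<Union>i\<in>I. P i)"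
      "pairwise (\<lambda>i j. separated H (P i) (P j)) I"
      "\<forall>i\<in>I. ef k (P i) H {1..m (fst i)} (F (fst i)) {}"
      unfolding comp_apply by blast
    then show thesis using that by metis
  qed
  have HM: "H \<subseteq> vertex_pairs M" using H(1) by (simp add: possible_def)
  have P: "P i \<subseteq> {1..M}" if "i \<in> I" for i using that H(2) by auto
  have "ef k {1..M + n} (H \<union> shift M E) {1..M} H {}" if E: "possible p n E" for n E
  proof -
    have En: "E \<subseteq> vertex_pairs n" using E by (simp add: possible_def)
    have "({1..n}, E) \<in> \<G>" using E by (auto simp: \<G>_def)
    then obtain c where c0: "c \<in> C" "case c of (V, F) \<Rightarrow> ef k V F {1..n} E {}"
      using C(3) by blast
    then have c: "c \<in> C" "ef k {1..m c} (F c) {1..n} E {}"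
      using mF[OF c0(1)] by (auto split: prod.splits)
    define G where "G = H \<union> shift M E"
    \<comment> \<open>\<open>None\<close> indexes the added graph, \<open>Some i\<close> the piece \<open>i\<close> of \<open>H\<close>.\<close>
    define J where "J = insert None (Some ` I)"
    define Q where "Q = case_option ((+) M ` {1..n}) P"
    define col where "col = case_option c (fst :: _ \<times> nat \<Rightarrow> _)"
    have "ef k (\<Union>j\<in>J. Q j) G (\<Union>i\<in>I. P i) H {}"
    proof (rule ef_families)
      show "finite J" "finite I" using finI by (auto simp: J_def)
      show "pairwise (\<lambda>i j. separated H (P i) (P j)) I" by (fact H(3))
      fix x
      have some: "card {j \<in> Some ` I. col j = x} = card {i \<in> I. fst i = x}"
      proof -
        have "{j \<in> Some ` I. col j = x} = Some ` {i \<in> I. fst i = x}"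
          by (auto simp: col_def)
        then show ?thesis by (simp add: card_image)
      qed
      show "card {j \<in> J. col j = x} = card {i \<in> I. fst i = x} \<or>
          k \<le> card {j \<in> J. col j = x} \<and> k \<le> card {i \<in> I. fst i = x}"
      proof (cases "x = c")
        case True
        have "card {j \<in> Some ` I. col j = x} \<le> card {j \<in> J. col j = x}"
          using finI by (intro card_mono) (auto simp: J_def)
        then show ?thesis using some cardI[OF c(1)] True by simp
      next
        case False
        then have "{j \<in> J. col j = x} = {j \<in> Some ` I. col j = x}"
          by (auto simp: J_def col_def)
        then show ?thesis using some by simp
      qed
    next
      fix j i assume j: "j \<in> J" and i: "i \<in> I" and eq: "col j = fst i"
      have Pi: "ef k {1..m (fst i)} (F (fst i)) (P i) H {}"
        using H(4)[OF i] by (rule ef_empty_sym)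
      show "ef k (Q j) G (P i) H {}"
      proof (cases j)
        case None
        then have "c = fst i" using eq by (simp add: col_def)
        then have "ef k {1..n} E (P i) H {}"
          using ef_empty_trans[OF ef_empty_sym[OF c(2)]] Pi by simp
        then show ?thesis
          unfolding G_def None Q_def option.case
          by (intro ef_empty_trans[OF ef_juxtapose_high[OF HM]]) auto
      next
        case (Some i')
        then have i': "i' \<in> I" "fst i' = fst i" using j eq by (auto simp: J_def col_def)
        have "ef k (P i') H (P i) H {}"
          using ef_empty_trans[OF H(4)[OF i'(1)]] Pi i'(2) by simp
        then show ?thesis
          unfolding G_def Some Q_def option.case
          by (intro ef_empty_trans[OF ef_juxtapose_low[OF En P[OF i'(1)]]])
      qed
    next
      have "separated G (P i) (P i')" if "i \<in> I" "i' \<in> I" "i \<noteq> i'" for i i'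
      proof -
        have "separated H (P i) (P i')" using H(3) that by (simp add: pairwise_def)
        moreover have "{a, b} \<notin> shift M E" if "a \<in> P i" for a b
          using P[OF \<open>i \<in> I\<close>] that by (intro pair_notin_shift[OF En]) auto
        ultimately show ?thesis by (auto simp: separated_def G_def)
      qed
      moreover have "separated G (P i) ((+) M ` {1..n})" if "i \<in> I" for i
        unfolding G_def by (rule separated_juxtapose[OF HM En P[OF that]]) auto
      ultimately show "pairwise (\<lambda>j j'. separated G (Q j) (Q j')) J"
        unfolding J_def pairwise_insert
        by (auto simp: Q_def pairwise_def separated_sym)
    qed
    moreover have "(\<Union>j\<in>J. Q j) = {1..M + n}"
    proof -
      have "(\<Union>j\<in>J. Q j) = {M + 1..M + n} \<union> {1..M}"
        unfolding H(2) J_def by (simp add: Q_def add.commute)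
      then show ?thesis by auto
    qed
    ultimately show ?thesis unfolding G_def H(2)[symmetric] by simp
  qed
  then show ?thesis using H(1) unfolding absorbing_def by blast
qed

text \<open>One equation covers both requirements: an edge that leaves the block would occur on its left-hand
  side only.\<close>

definition isolated_copy :: "nat \<Rightarrow> nat set set \<Rightarrow> nat \<Rightarrow> nat set set \<Rightarrow> bool" where
  "isolated_copy M H a E \<longleftrightarrow> {e \<in> E. e \<inter> {a + 1..a + M} \<noteq> {}} = shift a H"

lemma isolated_copy_pair_iff:
  assumes "isolated_copy M H a E" "x \<in> {1..M}"
  shows "{a + x, y} \<in> E \<longleftrightarrow> {a + x, y} \<in> shift a H"
proof -
  have "{a + x, y} \<inter> {a + 1..a + M} \<noteq> {}" using assms(2) by auto
  then show ?thesis using assms(1) unfolding isolated_copy_def by blast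
qed

lemma isolated_copy_ef:
  assumes "isolated_copy M H a E"
  shows "ef k ((+) a ` {1..M}) E {1..M} H {}"
proof (rule ef_empty_sym, rule ef_isomorphism)
  fix x y assume "x \<in> {1..M}"
  then show "{x, y} \<in> H \<longleftrightarrow> {a + x, a + y} \<in> E"
    using isolated_copy_pair_iff[OF assms] by simp
qed auto

text \<open>The remainder \<open>W\<close> of \<open>G\<close> outside the copy \<open>A\<close> of \<open>H\<close> need not be equivalent to any graph on
  an interval, so \<open>H\<close> cannot be asked to absorb it. Instead \<open>X\<close>, which is \<open>H\<close> followed by all of
  \<open>G\<close>, is read in two ways: \<open>H\<close> absorbs \<open>G\<close>, and \<open>H\<close> absorbs the copy of \<open>H\<close> inside \<open>G\<close>, after
  which \<open>W\<close> is left standing next to a single copy of \<open>H\<close>.\<close>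

lemma absorbing_isolated_copy:
  assumes abs: "absorbing k p M H" and poss: "possible p n E"
    and iso: "isolated_copy M H a E" and a: "a + M \<le> n"
  shows "ef k {1..n} E {1..M} H {}"
proof -
  have H: "possible p M H" using abs by (simp add: absorbing_def)
  have HM: "H \<subseteq> vertex_pairs M" and En: "E \<subseteq> vertex_pairs n"
    using H poss by (auto simp: possible_def)
  define A where "A = (+) a ` {1..M}"
  define W where "W = {1..n} - A"
  define X where "X = H \<union> shift M E"
  have A: "A \<subseteq> {1..n}" using a by (auto simp: A_def)
  have sepA: "separated E A W"
    unfolding separated_def
  proof (intro conjI ballI)
    fix x w assume x: "x \<in> A" and w: "w \<in> W"
    then obtain x' where x': "x = a + x'" "x' \<in> {1..M}" unfolding A_def by blast
    show "{x, w} \<notin> E"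
    proof
      assume "{x, w} \<in> E"
      then have "{x, w} \<in> shift a H"
        using isolated_copy_pair_iff[OF iso x'(2)] x'(1) by simp
      then have "a < w \<and> w \<le> a + M"
        using in_shift_bounds[OF _ HM] by blast
      then have "w \<in> A" by (auto simp: A_def)
      then show False using w by (simp add: W_def)
    qed
  qed (auto simp: W_def)
  have AE: "ef k A E {1..M} H {}"
    unfolding A_def by (rule isolated_copy_ef[OF iso])
  \<comment> \<open>\<open>H\<close> next to its copy inside \<open>E\<close> looks like that copy alone.\<close>
  have double: "ef k ({1..M} \<union> (+) M ` A) X A E {}"
  proof -
    let ?D = "H \<union> shift M H"
    have "ef k ((+) M ` A) X ((+) M ` {1..M}) ?D {}"
      using ef_juxtapose_high[OF HM A, of k E] AE
        ef_empty_sym[OF ef_juxtapose_high[OF HM order_refl, of k M H]]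
      unfolding X_def by (meson ef_empty_trans)
    moreover have "ef k {1..M} X {1..M} ?D {}"
      unfolding X_def
      using ef_juxtapose_low[OF En order_refl, of k M H]
        ef_empty_sym[OF ef_juxtapose_low[OF HM order_refl, of k M H]]
      by (rule ef_empty_trans)
    moreover have "separated X {1..M} ((+) M ` A)" "separated ?D {1..M} ((+) M ` {1..M})"
      unfolding X_def using HM En A by (auto intro!: separated_juxtapose)
    ultimately have "ef k ({1..M} \<union> (+) M ` A) X ({1..M} \<union> (+) M ` {1..M}) ?D {}"
      using ef_Un[of k "{1..M}" X "{1..M}" ?D "{}" "(+) M ` A" "(+) M ` {1..M}" "{}"] by simp
    also have "{1..M} \<union> (+) M ` {1..M} = {1..M + M}"
      by auto
    also have "ef k {1..M + M} ?D {1..M} H {}"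
      using abs H by (simp add: absorbing_def)
    finally show ?thesis
      using ef_empty_sym[OF AE] by (rule ef_empty_trans)
  qed
  have "ef k ((+) M ` W) X W E {}"
    unfolding X_def by (rule ef_juxtapose_high[OF HM, of _ n]) (auto simp: W_def)
  moreover have "separated X ({1..M} \<union> (+) M ` A) ((+) M ` W)"
    unfolding separated_def
  proof (intro conjI ballI)
    show "({1..M} \<union> (+) M ` A) \<inter> (+) M ` W = {}" by (auto simp: W_def)
    fix x w assume x: "x \<in> {1..M} \<union> (+) M ` A" and "w \<in> (+) M ` W"
    then obtain w' where w': "w = M + w'" "w' \<in> W" by auto
    have "M < w" using w' by (auto simp: W_def)
    show "{x, w} \<notin> X"
    proof (cases "x \<in> {1..M}")
      case True
      then show ?thesis
        using separated_juxtapose[OF HM En order_refl, of "{w}"] \<open>M < w\<close>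
        by (auto simp: separated_def X_def)
    next
      case False
      then obtain x' where x': "x = M + x'" "x' \<in> A" using x by auto
      have "{x', w'} \<notin> E" using sepA x'(2) w'(2) by (auto simp: separated_def)
      then show ?thesis
        using pair_notin_low[OF HM \<open>M < w\<close>] by (simp add: X_def x' w')
    qed
  qed
  ultimately have "ef k (({1..M} \<union> (+) M ` A) \<union> (+) M ` W) X (A \<union> W) E {}"
    using ef_Un[OF double, of "(+) M ` W" W "{}"] sepA by simp
  moreover have "A \<union> W = {1..n}" using A by (auto simp: W_def)
  moreover have "({1..M} \<union> (+) M ` A) \<union> (+) M ` W = {1..M + n}"
  proof -
    have "(+) M ` A \<union> (+) M ` W = (+) M ` {1..n}"
      using \<open>A \<union> W = {1..n}\<close> by (metis image_Un)
    then have "({1..M} \<union> (+) M ` A) \<union> (+) M ` W = {1..M} \<union> {M + 1..M + n}"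
      by (simp only: Un_assoc image_add_interval)
    then show ?thesis by auto
  qed
  ultimately have "ef k {1..M + n} X {1..n} E {}" by simp
  then have "ef k {1..n} E {1..M + n} X {}" by (rule ef_empty_sym)
  also have "ef k {1..M + n} X {1..M} H {}"
    using abs poss by (simp add: absorbing_def X_def)
  finally show ?thesis .
qed

section \<open>Prescribed edges and non-edges\<close>

lemma random_graph_possible:
  assumes p: "\<And>i. 1 \<le> i \<Longrightarrow> 0 \<le> p i \<and> p i \<le> 1" and E: "E \<in> set_pmf (random_graph n p)"
  shows "possible p n E"
proof -
  obtain c where c: "E = {e. c e}"
    "c \<in> set_pmf (Pi_pmf (vertex_pairs n) False (\<lambda>e. bernoulli_pmf (p (Max e - Min e))))"
    using E by (auto simp: random_graph_def)
  then have c': "c \<in> PiE_dflt (vertex_pairs n) False (\<lambda>e. set_pmf (bernoulli_pmf (p (Max e - Min e))))"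
    by (simp add: set_Pi_pmf comp_def)
  have "e \<in> vertex_pairs n \<and> 0 < p (Max e - Min e)" if "e \<in> E" for e
  proof
    show e: "e \<in> vertex_pairs n"
    proof (rule ccontr)
      assume "e \<notin> vertex_pairs n"
      then have "c e = False" using c' unfolding PiE_dflt_def by blast
      then show False using c(1) that by simp
    qed
    then have "1 \<le> Max e - Min e" by (elim vertex_pairsE) simp
    then have pe: "0 \<le> p (Max e - Min e)" "p (Max e - Min e) \<le> 1" using p by auto
    have "c e \<in> set_pmf (bernoulli_pmf (p (Max e - Min e)))"
      using c' e unfolding PiE_dflt_def by blast
    then have "True \<in> set_pmf (bernoulli_pmf (p (Max e - Min e)))"
      using c(1) that by simp
    then show "0 < p (Max e - Min e)"
      using pe by (auto simp: set_pmf_iff)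
  qed
  then show ?thesis by (auto simp: possible_def)
qed

text \<open>The probability that the pair \<open>e\<close> is an edge exactly if it belongs to the prescribed set \<open>S\<close>.\<close>

definition weight :: "(nat \<Rightarrow> real) \<Rightarrow> nat set set \<Rightarrow> nat set \<Rightarrow> real" where
  "weight p S e = (if e \<in> S then p (Max e - Min e) else 1 - p (Max e - Min e))"

lemma prob_edge_pattern:
  assumes p: "\<And>i. 1 \<le> i \<Longrightarrow> 0 \<le> p i \<and> p i \<le> 1" and K: "K \<subseteq> vertex_pairs n"
  shows "measure_pmf.prob (random_graph n p) {E. \<forall>e\<in>K. e \<in> E \<longleftrightarrow> e \<in> S} = (\<Prod>e\<in>K. weight p S e)"
proof -
  define B where "B = (\<lambda>e. if e \<in> K then {e \<in> S} else UNIV)"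
  have "measure_pmf.prob (random_graph n p) {E. \<forall>e\<in>K. e \<in> E \<longleftrightarrow> e \<in> S} =
      measure_pmf.prob (Pi_pmf (vertex_pairs n) False (\<lambda>e. bernoulli_pmf (p (Max e - Min e))))
        (Pi (vertex_pairs n) B)"
    unfolding random_graph_def measure_map_pmf
    using K by (intro arg_cong2[where f = measure]) (auto simp: B_def Pi_def split: if_splits)
  also have "\<dots> = (\<Prod>e\<in>vertex_pairs n. measure_pmf.prob (bernoulli_pmf (p (Max e - Min e))) (B e))"
    by (intro measure_Pi_pmf_Pi) auto
  also have "\<dots> = (\<Prod>e\<in>K. weight p S e)"
  proof (rule prod.mono_neutral_cong_right)
    fix e assume e: "e \<in> K"
    then have "1 \<le> Max e - Min e" using K by (auto elim!: vertex_pairsE)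
    then show "measure_pmf.prob (bernoulli_pmf (p (Max e - Min e))) (B e) = weight p S e"
      using p e by (auto simp: B_def weight_def measure_pmf_single)
  qed (use K in \<open>auto simp: B_def\<close>)
  finally show ?thesis .
qed

section \<open>Isolated copies of a fixed graph\<close>

text \<open>Chebyshev's inequality for the number \<open>X\<close> of events that occur: on the complement of the union
  \<open>X\<close> deviates from its mean \<open>S\<close> by \<open>S\<close>.\<close>

lemma (in prob_space) second_moment_union:
  assumes T: "finite T" and A: "\<And>a. a \<in> T \<Longrightarrow> A a \<in> events"
    and S: "S = (\<Sum>a\<in>T. prob (A a))" "0 < S"
    and second: "(\<Sum>a\<in>T. \<Sum>b\<in>T. prob (A a \<inter> A b)) \<le> (1 + \<eta>) * S\<^sup>2"
  shows "1 - \<eta> \<le> prob (\<Union>a\<in>T. A a)"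
proof -
  define U where "U = (\<Union>a\<in>T. A a)"
  define X where "X = (\<lambda>\<omega>. \<Sum>a\<in>T. indicat_real (A a) \<omega>)"
  have U: "U \<in> events" using T A by (auto simp: U_def)
  have sq: "(X \<omega> - S)\<^sup>2 = (\<Sum>a\<in>T. \<Sum>b\<in>T. indicat_real (A a \<inter> A b) \<omega>) - 2 * S * X \<omega> + S\<^sup>2" for \<omega>
    by (simp add: X_def power2_eq_square algebra_simps sum_product indicator_inter_arith)
  have intX: "integrable M X"
    unfolding X_def using A by (intro Bochner_Integration.integrable_sum) (simp add: emeasure_eq_measure)
  have EX: "expectation X = S"
    unfolding X_def S(1) using A
    by (subst Bochner_Integration.integral_sum) (auto simp: emeasure_eq_measure)
  have intP: "integrable M (\<lambda>\<omega>. \<Sum>a\<in>T. \<Sum>b\<in>T. indicat_real (A a \<inter> A b) \<omega>)"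
    using A by (intro Bochner_Integration.integrable_sum) (simp add: emeasure_eq_measure sets.Int)
  have EP: "expectation (\<lambda>\<omega>. \<Sum>a\<in>T. \<Sum>b\<in>T. indicat_real (A a \<inter> A b) \<omega>) =
      (\<Sum>a\<in>T. \<Sum>b\<in>T. prob (A a \<inter> A b))"
    using A by (simp add: Bochner_Integration.integral_sum emeasure_eq_measure sets.Int)
  have "S\<^sup>2 * prob (space M - U) = expectation (\<lambda>\<omega>. S\<^sup>2 * indicat_real (space M - U) \<omega>)"
    using U by simp
  also have "\<dots> \<le> expectation (\<lambda>\<omega>. (X \<omega> - S)\<^sup>2)"
  proof (rule integral_mono)
    show "integrable M (\<lambda>\<omega>. S\<^sup>2 * indicat_real (space M - U) \<omega>)"
      using U by (simp add: emeasure_eq_measure)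
    show "integrable M (\<lambda>\<omega>. (X \<omega> - S)\<^sup>2)"
      unfolding sq using intX intP by simp
    fix \<omega> assume "\<omega> \<in> space M"
    show "S\<^sup>2 * indicat_real (space M - U) \<omega> \<le> (X \<omega> - S)\<^sup>2"
    proof (cases "\<omega> \<in> space M - U")
      case True
      then have "X \<omega> = 0" by (auto simp: X_def U_def)
      then show ?thesis using True by simp
    qed simp
  qed
  also have "\<dots> = (\<Sum>a\<in>T. \<Sum>b\<in>T. prob (A a \<inter> A b)) - S\<^sup>2"
    unfolding sq using intX intP EX EP by (simp add: prob_space power2_eq_square)
  also have "\<dots> \<le> \<eta> * S\<^sup>2" using second by (simp add: algebra_simps)
  finally have "S\<^sup>2 * prob (space M - U) \<le> S\<^sup>2 * \<eta>" by (simp add: mult.commute)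
  then have "prob (space M - U) \<le> \<eta>" using S(2) by simp
  then show ?thesis using prob_compl[OF U] unfolding U_def by simp
qed

lemma prod_antimono:
  fixes f :: "'a \<Rightarrow> real"
  assumes "A \<subseteq> B" "finite B" "\<And>x. x \<in> B \<Longrightarrow> 0 \<le> f x \<and> f x \<le> 1"
  shows "prod f B \<le> prod f A"
proof -
  have "prod f B = prod f A * prod f (B - A)"
    using prod.subset_diff[OF assms(1,2), of f] by (simp add: mult.commute)
  also have "\<dots> \<le> prod f A * 1"
    using assms by (intro mult_left_mono prod_le_1 prod_nonneg) auto
  finally show ?thesis by simp
qed

definition block :: "nat \<Rightarrow> nat \<Rightarrow> nat set" where
  "block M a = {a + 1..a + M}"

lemma block_multiple_disjoint:
  assumes "0 < M" "s \<noteq> t"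
  shows "block M (M * s) \<inter> block M (M * t) = {}"
proof (rule ccontr)
  assume "block M (M * s) \<inter> block M (M * t) \<noteq> {}"
  then obtain x where "x \<in> block M (M * s)" "x \<in> block M (M * t)" by blast
  then have "M * s < x" "x \<le> M * s + M" "M * t < x" "x \<le> M * t + M"
    by (auto simp: block_def)
  then have "(x - 1) div M = s" "(x - 1) div M = t"
    by (auto intro!: div_nat_eqI simp: algebra_simps)
  then show False using assms(2) by simp
qed

text \<open>The pairs whose status decides whether \<open>A\<close> carries a prescribed graph and is cut off from the
  rest of \<open>{1..n}\<close>.\<close>

definition touching :: "nat \<Rightarrow> nat set \<Rightarrow> nat set set" where
  "touching n A = {e \<in> vertex_pairs n. e \<inter> A \<noteq> {}}"

lemma touching_subset: "touching n A \<subseteq> vertex_pairs n"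
  by (auto simp: touching_def)

lemma finite_touching [simp]: "finite (touching n A)"
  using finite_subset[OF touching_subset] by simp

lemma shift_subset_block:
  "H \<subseteq> vertex_pairs M \<Longrightarrow> e \<in> shift a H \<Longrightarrow> e \<subseteq> block M a"
  using in_shift_bounds[of e a H M] by (fastforce simp: block_def)

lemma isolated_copy_iff_pattern:
  assumes "E \<subseteq> vertex_pairs n" "H \<subseteq> vertex_pairs M" "a + M \<le> n"
  shows "isolated_copy M H a E \<longleftrightarrow> (\<forall>e\<in>touching n (block M a). e \<in> E \<longleftrightarrow> e \<in> shift a H)"
proof -
  have "shift a H \<subseteq> touching n (block M a)"
  proof
    fix e assume e: "e \<in> shift a H"
    have "e \<in> vertex_pairs (a + M)" using e shift_vertex_pairs[OF assms(2)] by blast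
    moreover from this have "e \<noteq> {}" by (auto simp: vertex_pairs_def)
    ultimately show "e \<in> touching n (block M a)"
      using shift_subset_block[OF assms(2) e] vertex_pairs_mono[OF assms(3)]
      by (auto simp: touching_def)
  qed
  then show ?thesis
    using assms(1) unfolding isolated_copy_def touching_def block_def by blast
qed

text \<open>A vertex has at most two others at each distance, so it is cut off with probability at least the
  square of the product over all distances.\<close>

lemma vertex_cut_off_ge:
  fixes p :: "nat \<Rightarrow> real"
  assumes p: "\<And>i. 1 \<le> i \<Longrightarrow> 0 \<le> p i \<and> p i \<le> 1" and i: "1 \<le> i" "i \<le> n"
  shows "(\<Prod>d=1..n. 1 - p d)\<^sup>2 \<le> (\<Prod>j\<in>{1..n} - {i}. 1 - p (max i j - min i j))"
proof -
  define W where "W = (\<Prod>d=1..n. 1 - p d)"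
  have W: "W \<ge> 0" unfolding W_def by (rule prod_nonneg) (use p in auto)
  have "W \<le> (\<Prod>d\<in>{1..<i}. 1 - p d)" unfolding W_def
    using p i by (intro prod_antimono) auto
  also have "\<dots> = (\<Prod>j\<in>{1..<i}. 1 - p (max i j - min i j))"
    by (rule prod.reindex_bij_witness[of _ "\<lambda>j. i - j" "\<lambda>j. i - j"]) (auto simp: max_def min_def)
  finally have lower: "W \<le> (\<Prod>j\<in>{1..<i}. 1 - p (max i j - min i j))" .
  have "W \<le> (\<Prod>d\<in>{1..n - i}. 1 - p d)" unfolding W_def
    using p i by (intro prod_antimono) auto
  also have "\<dots> = (\<Prod>j\<in>{i<..n}. 1 - p (max i j - min i j))"
    by (rule prod.reindex_bij_witness[of _ "\<lambda>j. j - i" "\<lambda>j. j + i"]) (use i in \<open>auto simp: max_def min_def\<close>)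
  finally have upper: "W \<le> (\<Prod>j\<in>{i<..n}. 1 - p (max i j - min i j))" .
  have "W\<^sup>2 \<le> (\<Prod>j\<in>{1..<i}. 1 - p (max i j - min i j)) * (\<Prod>j\<in>{i<..n}. 1 - p (max i j - min i j))"
    unfolding power2_eq_square using W lower upper by (intro mult_mono) auto
  also have "\<dots> = (\<Prod>j\<in>{1..<i} \<union> {i<..n}. 1 - p (max i j - min i j))"
    by (rule prod.union_disjoint[symmetric]) auto
  also have "{1..<i} \<union> {i<..n} = {1..n} - {i}" using i by auto
  finally show ?thesis by (simp add: W_def)
qed

lemma length_pair: "Max {i, j} - Min {i, j} = max i j - min i (j :: nat)"
  by simp

text \<open>The pairs touching the block split into those inside it, whose contribution is that of \<open>H\<close> on
  \<open>{1..M}\<close>, and those leaving it, where each of the \<open>M\<close> vertices costs at most two factors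
  \<open>(\<Prod>d=1..n. 1 - p d)\<close>.\<close>

lemma pattern_weight_ge:
  assumes p: "\<And>i. 1 \<le> i \<Longrightarrow> 0 \<le> p i \<and> p i \<le> 1" and H: "H \<subseteq> vertex_pairs M" and a: "a + M \<le> n"
  shows "(\<Prod>e\<in>vertex_pairs M. weight p H e) * ((\<Prod>d=1..n. 1 - p d) ^ (2 * M))
    \<le> (\<Prod>e\<in>touching n (block M a). weight p (shift a H) e)"
proof -
  let ?I = "block M a" and ?W = "\<Prod>d=1..n. 1 - p d"
  let ?in = "shift a (vertex_pairs M)" and ?out = "(\<lambda>(i, j). {i, j}) ` (?I \<times> ({1..n} - ?I))"
  have inj_add: "inj_on ((`) ((+) a)) (vertex_pairs M)"
    by (intro inj_onI) (simp add: inj_image_eq_iff)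
  have inj_pair: "inj_on (\<lambda>(i, j). {i, j}) (?I \<times> ({1..n} - ?I))"
    by (intro inj_onI) (auto simp: doubleton_eq_iff)
  have I: "?I = (+) a ` {1..M}" "?I \<subseteq> {1..n}" using a by (auto simp: block_def)
  have split: "touching n ?I = ?in \<union> ?out"
  proof (intro equalityI subsetI)
    fix e assume e: "e \<in> touching n ?I"
    then obtain x y where xy: "e = {x, y}" "x \<in> ?I" "y \<in> {1..n}" "x \<noteq> y"
    proof -
      from e have "e \<in> vertex_pairs n" by (simp add: touching_def)
      then obtain x y where "e = {x, y}" "x < y" "1 \<le> x" "y \<le> n" by (rule vertex_pairsE)
      then show ?thesis using e that[of x y] that[of y x]
        by (auto simp: touching_def insert_commute)
    qed
    show "e \<in> ?in \<union> ?out"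
    proof (cases "y \<in> ?I")
      case True
      then obtain x' y' where "x = a + x'" "y = a + y'" "x' \<in> {1..M}" "y' \<in> {1..M}"
        using xy(2) unfolding I(1) by blast
      then have "e \<in> ?in" using xy(1,4) by simp
      then show ?thesis by blast
    next
      case False
      then show ?thesis using xy by blast
    qed
  next
    fix e assume "e \<in> ?in \<union> ?out"
    then show "e \<in> touching n ?I"
    proof
      assume e: "e \<in> ?in"
      have "e \<in> vertex_pairs (a + M)" using e shift_vertex_pairs by blast
      moreover from this have "e \<noteq> {}" by (auto simp: vertex_pairs_def)
      ultimately show ?thesis
        using shift_subset_block[OF order_refl e] vertex_pairs_mono[OF a]
        by (auto simp: touching_def)
    next
      assume "e \<in> ?out"
      then show ?thesis using I(2) by (auto simp: touching_def)
    qed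
  qed
  have out_notin: "\<not> e \<subseteq> ?I" if "e \<in> ?out" for e using that by auto
  have disj: "?in \<inter> ?out = {}"
    using shift_subset_block[OF order_refl] out_notin by blast
  have fin: "finite ?in" "finite ?out"
    using finite_touching[of n ?I] unfolding split by auto
  have "(\<Prod>e\<in>?in. weight p (shift a H) e) = (\<Prod>e\<in>vertex_pairs M. weight p (shift a H) ((+) a ` e))"
    unfolding shift_def using inj_add by (simp add: prod.reindex)
  also have "\<dots> = (\<Prod>e\<in>vertex_pairs M. weight p H e)"
  proof (rule prod.cong)
    fix e assume e: "e \<in> vertex_pairs M"
    then obtain x y where xy: "e = {x, y}" by (elim vertex_pairsE)
    have "(+) a ` e \<in> shift a H \<longleftrightarrow> e \<in> H" unfolding xy by simp
    then show "weight p (shift a H) ((+) a ` e) = weight p H e"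
      using length_translate[OF e] by (simp add: weight_def)
  qed simp
  finally have inner: "(\<Prod>e\<in>?in. weight p (shift a H) e) = (\<Prod>e\<in>vertex_pairs M. weight p H e)" .
  have "?W ^ (2 * M) = (\<Prod>i\<in>?I. ?W\<^sup>2)"
    by (simp add: block_def power_mult)
  also have "\<dots> \<le> (\<Prod>i\<in>?I. \<Prod>j\<in>{1..n} - ?I. 1 - p (max i j - min i j))"
  proof (rule prod_mono)
    fix i assume i: "i \<in> ?I"
    then have i': "1 \<le> i" "i \<le> n" using I(2) by auto
    have "?W\<^sup>2 \<le> (\<Prod>j\<in>{1..n} - {i}. 1 - p (max i j - min i j))"
      by (rule vertex_cut_off_ge[OF p i']) 
    also have "\<dots> \<le> (\<Prod>j\<in>{1..n} - ?I. 1 - p (max i j - min i j))"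
    proof (rule prod_antimono)
      fix j assume "j \<in> {1..n} - {i}"
      then have "1 \<le> max i j - min i j" by auto
      then show "0 \<le> 1 - p (max i j - min i j) \<and> 1 - p (max i j - min i j) \<le> 1" using p by auto
    qed (use i in auto)
    finally show "0 \<le> ?W\<^sup>2 \<and> ?W\<^sup>2 \<le> (\<Prod>j\<in>{1..n} - ?I. 1 - p (max i j - min i j))"
      by simp
  qed
  also have "\<dots> = (\<Prod>(i, j)\<in>?I \<times> ({1..n} - ?I). 1 - p (max i j - min i j))"
    by (rule prod.cartesian_product)
  also have "\<dots> = (\<Prod>(i, j)\<in>?I \<times> ({1..n} - ?I). weight p (shift a H) {i, j})"
  proof (rule prod.cong)
    fix x assume x: "x \<in> ?I \<times> ({1..n} - ?I)"
    then obtain i j where ij: "x = (i, j)" "j \<notin> ?I" by auto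
    then have "{i, j} \<notin> shift a H"
      using shift_subset_block[OF H, of "{i, j}" a] by auto
    then show "(case x of (i, j) \<Rightarrow> 1 - p (max i j - min i j)) =
        (case x of (i, j) \<Rightarrow> weight p (shift a H) {i, j})"
      by (simp add: weight_def length_pair ij)
  qed simp
  also have "\<dots> = (\<Prod>e\<in>?out. weight p (shift a H) e)"
    using inj_pair by (simp add: prod.reindex split_def)
  finally have outer: "?W ^ (2 * M) \<le> (\<Prod>e\<in>?out. weight p (shift a H) e)" .
  have len1: "1 \<le> Max e - Min e" if "e \<in> vertex_pairs M" for e
    using that by (elim vertex_pairsE) simp
  have "0 \<le> (\<Prod>e\<in>vertex_pairs M. weight p H e)"
    using p[OF len1] by (intro prod_nonneg) (auto simp: weight_def)
  then show ?thesis
    unfolding split prod.union_disjoint[OF fin disj] inner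
    using outer by (rule mult_left_mono[rotated])
qed

lemma card_touching_both:
  assumes "A \<inter> B = {}" "finite A" "finite B"
  shows "card (touching n A \<inter> touching n B) \<le> card A * card B"
proof -
  have "touching n A \<inter> touching n B \<subseteq> (\<lambda>(i, j). {i, j}) ` (A \<times> B)"
  proof
    fix e assume e: "e \<in> touching n A \<inter> touching n B"
    then obtain x y where "e = {x, y}" by (metis IntD1 subsetD touching_subset vertex_pairsE)
    then have "\<exists>i\<in>A. \<exists>j\<in>B. e = {i, j}"
      using e assms(1) by (auto simp: touching_def insert_commute)
    then show "e \<in> (\<lambda>(i, j). {i, j}) ` (A \<times> B)" by auto
  qed
  then have "card (touching n A \<inter> touching n B) \<le> card ((\<lambda>(i, j). {i, j}) ` (A \<times> B))"
    using assms by (intro card_mono) auto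
  also have "\<dots> \<le> card (A \<times> B)" using assms by (intro card_image_le) auto
  finally show ?thesis by (simp add: card_cartesian_product)
qed

text \<open>The events for two blocks share only the pairs running between the blocks, and both prescribe
  non-edges there. Counting these shared factors once instead of twice is the only correlation.\<close>

lemma prob_two_patterns:
  assumes p: "\<And>i. 1 \<le> i \<Longrightarrow> 0 \<le> p i \<and> p i \<le> 1" and H: "H \<subseteq> vertex_pairs M"
    and disj: "block M a \<inter> block M b = {}" and \<delta>: "0 \<le> \<delta>" "\<delta> \<le> 1"
    and good: "\<And>e. e \<in> touching n (block M a) \<inter> touching n (block M b) \<Longrightarrow> p (Max e - Min e) \<le> \<delta>"
    and A: "A = (\<lambda>a. {E. \<forall>e\<in>touching n (block M a). e \<in> E \<longleftrightarrow> e \<in> shift a H})"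
  shows "measure_pmf.prob (random_graph n p) (A a \<inter> A b) * (1 - \<delta>) ^ (M * M) \<le>
    measure_pmf.prob (random_graph n p) (A a) * measure_pmf.prob (random_graph n p) (A b)"
proof -
  let ?P = "measure_pmf.prob (random_graph n p)"
  let ?S = "shift a H \<union> shift b H"
  let ?Ta = "touching n (block M a)" and ?Tb = "touching n (block M b)"
  have eqa: "e \<in> ?S \<longleftrightarrow> e \<in> shift a H" if "e \<in> ?Ta" for e
    using that shift_subset_block[OF H, of e b] disj by (auto simp: touching_def)
  have eqb: "e \<in> ?S \<longleftrightarrow> e \<in> shift b H" if "e \<in> ?Tb" for e
    using that shift_subset_block[OF H, of e a] disj by (auto simp: touching_def)
  have Aa: "A a = {E. \<forall>e\<in>?Ta. e \<in> E \<longleftrightarrow> e \<in> ?S}" unfolding A using eqa by auto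
  have Ab: "A b = {E. \<forall>e\<in>?Tb. e \<in> E \<longleftrightarrow> e \<in> ?S}" unfolding A using eqb by auto
  have Aab: "A a \<inter> A b = {E. \<forall>e\<in>?Ta \<union> ?Tb. e \<in> E \<longleftrightarrow> e \<in> ?S}" unfolding Aa Ab by blast
  have sub: "?Ta \<subseteq> vertex_pairs n" "?Tb \<subseteq> vertex_pairs n" "?Ta \<union> ?Tb \<subseteq> vertex_pairs n"
    using touching_subset by auto
  have prod_eq: "?P (A a \<inter> A b) * (\<Prod>e\<in>?Ta \<inter> ?Tb. weight p ?S e) = ?P (A a) * ?P (A b)"
  proof -
    have "?P (A a \<inter> A b) = (\<Prod>e\<in>?Ta \<union> ?Tb. weight p ?S e)"
      unfolding Aab by (rule prob_edge_pattern[OF p sub(3)])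
    moreover have "?P (A a) = (\<Prod>e\<in>?Ta. weight p ?S e)"
      unfolding Aa by (rule prob_edge_pattern[OF p sub(1)])
    moreover have "?P (A b) = (\<Prod>e\<in>?Tb. weight p ?S e)"
      unfolding Ab by (rule prob_edge_pattern[OF p sub(2)])
    ultimately show ?thesis by (simp add: prod.union_inter)
  qed
  have "(1 - \<delta>) ^ (M * M) \<le> (1 - \<delta>) ^ card (?Ta \<inter> ?Tb)"
    using card_touching_both[OF disj, of n] \<delta> by (intro power_decreasing) (auto simp: block_def)
  also have "\<dots> = (\<Prod>e\<in>?Ta \<inter> ?Tb. 1 - \<delta>)" by simp
  also have "\<dots> \<le> (\<Prod>e\<in>?Ta \<inter> ?Tb. weight p ?S e)"
  proof (rule prod_mono)
    fix e assume e: "e \<in> ?Ta \<inter> ?Tb"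
    then have "e \<notin> ?S"
      using eqa[of e] eqb[of e] shift_subset_block[OF H, of e a] shift_subset_block[OF H, of e b] disj
      by (auto simp: touching_def)
    then show "0 \<le> 1 - \<delta> \<and> 1 - \<delta> \<le> weight p ?S e"
      using good[OF e] \<delta> by (simp add: weight_def)
  qed
  finally have "(1 - \<delta>) ^ (M * M) \<le> (\<Prod>e\<in>?Ta \<inter> ?Tb. weight p ?S e)" .
  then show ?thesis unfolding prod_eq[symmetric] by (intro mult_left_mono) auto
qed

text \<open>A block \<open>b\<close> that sees the block \<open>a\<close> at a distance in \<open>D\<close> is determined by a vertex of \<open>a\<close>, the
  distance, and the direction.\<close>

lemma card_bad_blocks:
  assumes M: "0 < M" and D: "finite D" "a \<in> (*) M ` UNIV"
  shows "card {b \<in> (*) M ` {..<N}. \<exists>e\<in>touching n (block M a) \<inter> touching n (block M b).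
      b \<noteq> a \<and> Max e - Min e \<in> D} \<le> 2 * M * card D"
proof -
  define f where "f = (\<lambda>(i, d, up). M * (((if up then i + d else i - d) - 1) div M))"
  let ?bad = "{b \<in> (*) M ` {..<N}. \<exists>e\<in>touching n (block M a) \<inter> touching n (block M b).
      b \<noteq> a \<and> Max e - Min e \<in> D}"
  have "?bad \<subseteq> f ` (block M a \<times> D \<times> (UNIV :: bool set))"
  proof
    fix b assume "b \<in> ?bad"
    then obtain e s where e: "e \<in> touching n (block M a)" "e \<in> touching n (block M b)" "b \<noteq> a"
      "Max e - Min e \<in> D" and s: "b = M * s" by auto
    from D(2) obtain t where t: "a = M * t" by auto
    have disj: "block M a \<inter> block M b = {}"
      using e(3) unfolding s t by (intro block_multiple_disjoint[OF M]) auto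
    from e(1) obtain x y where xy: "e = {x, y}" by (metis subsetD touching_subset vertex_pairsE)
    have "\<exists>i j. e = {i, j} \<and> i \<in> block M a \<and> j \<in> block M b"
    proof (cases "x \<in> block M a")
      case True
      then show ?thesis using e(2) disj xy by (auto simp: touching_def)
    next
      case False
      then show ?thesis using e(1,2) disj xy by (auto simp: touching_def insert_commute)
    qed
    then obtain i j where ij: "e = {i, j}" "i \<in> block M a" "j \<in> block M b" by blast
    let ?d = "Max e - Min e"
    have j: "j = (if i < j then i + ?d else i - ?d)"
      unfolding ij(1) length_pair by (auto simp: max_def min_def)
    have "(j - 1) div M = s"
      using ij(3) by (auto intro!: div_nat_eqI simp: block_def s algebra_simps)
    then have "b = f (i, ?d, i < j)"
      unfolding f_def s using j by simp
    then show "b \<in> f ` (block M a \<times> D \<times> UNIV)" using ij(2) e(4) by blast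
  qed
  then have "card ?bad \<le> card (f ` (block M a \<times> D \<times> (UNIV :: bool set)))"
    using D(1) by (intro card_mono) (auto simp: block_def)
  also have "\<dots> \<le> card (block M a \<times> D \<times> (UNIV :: bool set))"
    using D(1) by (intro card_image_le) (auto simp: block_def)
  also have "\<dots> = 2 * M * card D"
    by (simp add: card_cartesian_product block_def)
  finally show ?thesis .
qed

lemma pattern_weight_pos:
  assumes p: "\<And>i. 1 \<le> i \<Longrightarrow> 0 \<le> p i \<and> p i < 1" and H: "possible p M H"
  shows "0 < (\<Prod>e\<in>vertex_pairs M. weight p H e)"
proof (rule prod_pos)
  fix e assume "e \<in> vertex_pairs M"
  then have "1 \<le> Max e - Min e" by (elim vertex_pairsE) simp
  then have "p (Max e - Min e) < 1" using p by blast
  then show "0 < weight p H e" using H by (simp add: weight_def possible_def)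
qed

text \<open>Few distances can have a probability above \<open>\<delta>\<close>, because each of them costs a factor \<open>1 - \<delta>\<close> in
  the product.\<close>

lemma card_likely_distances:
  fixes p :: "nat \<Rightarrow> real"
  assumes p: "\<And>i. 1 \<le> i \<Longrightarrow> 0 \<le> p i \<and> p i < 1" and \<delta>: "0 < \<delta>" "\<delta> < 1"
  shows "real (card {d \<in> {1..n}. \<delta> < p d}) * - ln (1 - \<delta>) \<le> - ln (\<Prod>d=1..n. 1 - p d)"
proof -
  let ?D = "{d \<in> {1..n}. \<delta> < p d}"
  have pos: "0 < (\<Prod>d=1..n. 1 - p d)" using p by (intro prod_pos) auto
  have "(\<Prod>d=1..n. 1 - p d) \<le> (\<Prod>d\<in>?D. 1 - p d)"
    using p by (intro prod_antimono) (auto simp: less_imp_le)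
  also have "\<dots> \<le> (\<Prod>d\<in>?D. 1 - \<delta>)"
    using p by (intro prod_mono) (auto simp: less_imp_le)
  finally have "(\<Prod>d=1..n. 1 - p d) \<le> (1 - \<delta>) ^ card ?D" by simp
  then have "ln (\<Prod>d=1..n. 1 - p d) \<le> ln ((1 - \<delta>) ^ card ?D)"
    using pos \<delta> by (subst ln_le_cancel_iff) auto
  then show ?thesis using \<delta> by (simp add: ln_realpow)
qed

text \<open>The second moment of the number of isolated copies on the blocks at multiples of \<open>M\<close>. Let \<open>S\<close>
  be its mean. A pair of blocks at unlikely distances only is almost independent and contributes to
  the factor \<open>1 + \<eta>\<close>. For the other pairs the joint probability is bounded by that of the first
  block. With \<open>D\<close> the set of likely distances, each block is in \<open>2 * M * card D\<close> such pairs at most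
  (\<open>card_bad_blocks\<close>) and in one more with itself, so they contribute at most
  \<open>(2 * M * card D + 1) * S\<close>, and the last hypothesis makes this at most \<open>\<eta> * S\<^sup>2\<close>.\<close>

lemma isolated_copy_likely:
  assumes p: "\<And>i. 1 \<le> i \<Longrightarrow> 0 \<le> p i \<and> p i < 1" and H: "possible p M H"
    and M: "0 < M" and \<delta>: "0 < \<delta>" "\<delta> < 1" and \<eta>: "0 < \<eta>" "1 \<le> (1 + \<eta>) * (1 - \<delta>) ^ (M * M)"
    and few: "real (2 * M * card {d \<in> {1..n}. \<delta> < p d} + 1) \<le>
      \<eta> * (real (n div M) * (\<Prod>e\<in>vertex_pairs M. weight p H e) * (\<Prod>d=1..n. 1 - p d) ^ (2 * M))"
  shows "1 - 2 * \<eta> \<le>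
    measure_pmf.prob (random_graph n p) {E. \<exists>a. a + M \<le> n \<and> isolated_copy M H a E}"
proof -
  let ?P = "measure_pmf.prob (random_graph n p)"
  have p': "\<And>i. 1 \<le> i \<Longrightarrow> 0 \<le> p i \<and> p i \<le> 1" using p by (meson less_imp_le)
  have HM: "H \<subseteq> vertex_pairs M" using H by (simp add: possible_def)
  define A where "A = (\<lambda>a. {E. \<forall>e\<in>touching n (block M a). e \<in> E \<longleftrightarrow> e \<in> shift a H})"
  define T where "T = (*) M ` {..<n div M}"
  define D where "D = {d \<in> {1..n}. \<delta> < p d}"
  define q where "q = (\<Prod>e\<in>vertex_pairs M. weight p H e)"
  define W where "W = (\<Prod>d=1..n. 1 - p d)"
  define S where "S = (\<Sum>a\<in>T. ?P (A a))"
  have finD: "finite D" and finT: "finite T" by (auto simp: D_def T_def)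
  have room: "a + M \<le> n" if a: "a \<in> T" for a
  proof -
    obtain s where s: "a = M * s" "s < n div M" using a by (auto simp: T_def)
    have "a + M = M * Suc s" using s(1) by simp
    also have "\<dots> \<le> M * (n div M)" using s(2) by (intro mult_le_mono2) simp
    also have "\<dots> \<le> n" by simp
    finally show ?thesis .
  qed
  have cardT: "card T = n div M"
    unfolding T_def using M by (subst card_image) (auto intro: inj_onI)
  have PA: "q * W ^ (2 * M) \<le> ?P (A a)" if "a \<in> T" for a
  proof -
    have "?P (A a) = (\<Prod>e\<in>touching n (block M a). weight p (shift a H) e)"
      unfolding A_def by (rule prob_edge_pattern[OF p' touching_subset])
    then show ?thesis
      using pattern_weight_ge[OF p' HM room[OF that]] by (simp add: q_def W_def)
  qed
  have "real (n div M) * (q * W ^ (2 * M)) \<le> S"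
    unfolding S_def using sum_mono[OF PA, of T "\<lambda>a. a"] by (simp add: cardT)
  then have "\<eta> * (real (n div M) * (q * W ^ (2 * M))) \<le> \<eta> * S"
    using \<eta>(1) by (intro mult_left_mono) auto
  then have few': "real (2 * M * card D + 1) \<le> \<eta> * S"
    using few unfolding D_def[symmetric] q_def[symmetric] W_def[symmetric]
    by (simp add: mult.assoc)
  then have S_pos: "0 < S" using \<eta>(1) by (smt (verit) of_nat_0_le_iff of_nat_add of_nat_1 zero_less_mult_pos)
  have row: "(\<Sum>b\<in>T. ?P (A a \<inter> A b)) \<le> (1 + \<eta>) * ?P (A a) * S + real (2 * M * card D + 1) * ?P (A a)"
    if a: "a \<in> T" for a
  proof -
    define bad where "bad = {b \<in> T. \<exists>e\<in>touching n (block M a) \<inter> touching n (block M b).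
      b \<noteq> a \<and> Max e - Min e \<in> D}"
    have "card (insert a bad) \<le> Suc (card bad)" by (rule card_insert_le_m1) simp_all
    moreover have "card bad \<le> 2 * M * card D"
      unfolding bad_def T_def using a by (intro card_bad_blocks[OF M finD]) (auto simp: T_def)
    ultimately have card_bad: "card (insert a bad) \<le> 2 * M * card D + 1" by simp
    have sub: "insert a bad \<subseteq> T" using a by (auto simp: bad_def)
    have good: "?P (A a \<inter> A b) \<le> (1 + \<eta>) * ?P (A a) * ?P (A b)" if b: "b \<in> T - insert a bad" for b
    proof -
      have disj: "block M a \<inter> block M b = {}"
      proof -
        obtain s t where st: "a = M * s" "b = M * t" using a b by (auto simp: T_def)
        then have "s \<noteq> t" using b by auto
        then show ?thesis unfolding st by (rule block_multiple_disjoint[OF M])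
      qed
      have close: "p (Max e - Min e) \<le> \<delta>" if e: "e \<in> touching n (block M a) \<inter> touching n (block M b)" for e
      proof -
        have "Max e - Min e \<notin> D" using b e by (auto simp: bad_def)
        moreover have "Max e - Min e \<in> {1..n}"
          using e by (auto simp: touching_def elim!: vertex_pairsE)
        ultimately show ?thesis by (auto simp: D_def)
      qed
      have two: "?P (A a \<inter> A b) * (1 - \<delta>) ^ (M * M) \<le> ?P (A a) * ?P (A b)"
        by (rule prob_two_patterns[where p = p, OF p' HM disj less_imp_le[OF \<delta>(1)] less_imp_le[OF \<delta>(2)] close A_def])
      have "?P (A a \<inter> A b) \<le> ?P (A a \<inter> A b) * ((1 + \<eta>) * (1 - \<delta>) ^ (M * M))"
        using mult_left_mono[OF \<eta>(2), of "?P (A a \<inter> A b)"] by simp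
      also have "\<dots> = (1 + \<eta>) * (?P (A a \<inter> A b) * (1 - \<delta>) ^ (M * M))" by (simp add: ac_simps)
      also have "\<dots> \<le> (1 + \<eta>) * (?P (A a) * ?P (A b))"
        using two \<eta>(1) by (intro mult_left_mono) auto
      finally show ?thesis by (simp add: mult.assoc)
    qed
    have "(\<Sum>b\<in>T. ?P (A a \<inter> A b)) =
        (\<Sum>b\<in>T - insert a bad. ?P (A a \<inter> A b)) + (\<Sum>b\<in>insert a bad. ?P (A a \<inter> A b))"
      using sum.subset_diff[OF sub finT] by simp
    also have "(\<Sum>b\<in>T - insert a bad. ?P (A a \<inter> A b)) \<le>
        (\<Sum>b\<in>T - insert a bad. (1 + \<eta>) * ?P (A a) * ?P (A b))"
      by (rule sum_mono[OF good])
    also have "\<dots> \<le> (\<Sum>b\<in>T. (1 + \<eta>) * ?P (A a) * ?P (A b))"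
      using finT \<eta>(1) by (intro sum_mono2) auto
    also have "\<dots> = (1 + \<eta>) * ?P (A a) * S" by (simp add: S_def sum_distrib_left)
    also have "(\<Sum>b\<in>insert a bad. ?P (A a \<inter> A b)) \<le> (\<Sum>b\<in>insert a bad. ?P (A a))"
      by (intro sum_mono measure_pmf.finite_measure_mono) auto
    also have "\<dots> = real (card (insert a bad)) * ?P (A a)" by simp
    also have "\<dots> \<le> real (2 * M * card D + 1) * ?P (A a)"
      using card_bad by (intro mult_right_mono of_nat_mono) auto
    finally show ?thesis by simp
  qed
  have "(\<Sum>a\<in>T. \<Sum>b\<in>T. ?P (A a \<inter> A b)) \<le>
      (\<Sum>a\<in>T. (1 + \<eta>) * ?P (A a) * S + real (2 * M * card D + 1) * ?P (A a))"
    by (rule sum_mono[OF row])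
  also have "\<dots> = (1 + \<eta>) * S * S + real (2 * M * card D + 1) * S"
    unfolding sum.distrib sum_distrib_right[symmetric] sum_distrib_left[symmetric] S_def[symmetric] ..
  also have "\<dots> \<le> (1 + \<eta>) * S * S + \<eta> * S * S"
    using few' S_pos by (intro add_left_mono mult_right_mono) auto
  also have "\<dots> = (1 + 2 * \<eta>) * S\<^sup>2" by (simp add: power2_eq_square algebra_simps)
  finally have "1 - 2 * \<eta> \<le> ?P (\<Union>a\<in>T. A a)"
    using measure_pmf.second_moment_union[OF finT _ S_def S_pos] by simp
  also have "\<dots> = measure_pmf.prob (random_graph n p) ((\<Union>a\<in>T. A a) \<inter> set_pmf (random_graph n p))"
    by (simp add: measure_Int_set_pmf)
  also have "\<dots> \<le> ?P {E. \<exists>a. a + M \<le> n \<and> isolated_copy M H a E}"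
  proof (rule measure_pmf.finite_measure_mono)
    have "\<exists>a. a + M \<le> n \<and> isolated_copy M H a E"
      if a: "a \<in> T" "E \<in> A a" and E: "E \<in> set_pmf (random_graph n p)" for a E
    proof -
      have "E \<subseteq> vertex_pairs n" using random_graph_possible[OF p' E] by (simp add: possible_def)
      then have "isolated_copy M H a E"
        using isolated_copy_iff_pattern[OF _ HM room[OF a(1)]] a(2) by (simp add: A_def)
      then show ?thesis using room[OF a(1)] by blast
    qed
    then show "(\<Union>a\<in>T. A a) \<inter> set_pmf (random_graph n p) \<subseteq> {E. \<exists>a. a + M \<le> n \<and> isolated_copy M H a E}"
      by blast
  qed simp
  finally show ?thesis .
qed

text \<open>The quantities in \<open>isolated_copy_likely\<close> are compared for large \<open>n\<close>: once the product exceeds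
  \<open>n powr - \<gamma>\<close> with \<open>\<gamma> = 1 / (4 * M)\<close>, the mean is at least of order \<open>n powr (1 / 2)\<close>, whereas
  the number of likely distances is only \<open>O(ln n)\<close>.\<close>

lemma isolated_copy_tendsto:
  assumes p: "\<And>i. 1 \<le> i \<Longrightarrow> 0 \<le> p i \<and> p i < 1"
    and lim: "(\<lambda>n. ln (\<Prod>i=1..n. 1 - p i) / ln (real n)) \<longlonglongrightarrow> 0"
    and H: "possible p M H"
  shows "(\<lambda>n. measure_pmf.prob (random_graph n p) {E. \<exists>a. a + M \<le> n \<and> isolated_copy M H a E})
    \<longlonglongrightarrow> 1"
proof (cases "M = 0")
  case True
  then have "H = {}" using H by (auto simp: possible_def vertex_pairs_def)
  then have "isolated_copy M H 0 E" for E
    using True by (auto simp: isolated_copy_def shift_def)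
  then have "{E. \<exists>a. a + M \<le> n \<and> isolated_copy M H a E} = UNIV" for n
    using True by auto
  then show ?thesis by simp
next
  case False
  then have M: "0 < M" by simp
  define q where "q = (\<Prod>e\<in>vertex_pairs M. weight p H e)"
  have q: "0 < q" unfolding q_def by (rule pattern_weight_pos[OF p H])
  show ?thesis
  proof (rule LIMSEQ_I)
    fix r :: real assume r: "0 < r"
    define \<eta> where "\<eta> = min (r / 4) (1 / 2)"
    \<comment> \<open>Bernoulli's inequality needs \<open>M\<^sup>2 * \<delta> \<le> \<eta> / 2\<close>.\<close>
    define \<delta> where "\<delta> = \<eta> / (2 * (real (M * M) + 1))"
    have \<eta>: "0 < \<eta>" "\<eta> \<le> 1 / 2" "2 * \<eta> < r" using r by (auto simp: \<eta>_def)
    have M\<delta>: "(real (M * M) + 1) * \<delta> = \<eta> / 2"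
    proof -
      have "0 < real (M * M) + 1" by (simp add: add_nonneg_pos)
      then show ?thesis unfolding \<delta>_def by (simp add: divide_simps)
    qed
    have \<delta>: "0 < \<delta>" unfolding \<delta>_def using \<eta>(1) by (intro divide_pos_pos) (auto simp: add_nonneg_pos)
    then have M\<delta>: "real (M * M) * \<delta> \<le> \<eta> / 2" "\<delta> \<le> \<eta> / 2"
      using M\<delta> mult_nonneg_nonneg[of "real (M * M)" \<delta>] by (auto simp: distrib_right)
    then have \<delta>: "0 < \<delta>" "\<delta> < 1" using \<delta> \<eta> by auto
    have "1 \<le> (1 + \<eta>) * (1 - \<eta> / 2)"
      using \<eta> by (simp add: algebra_simps)
    also have "\<dots> \<le> (1 + \<eta>) * (1 + real (M * M) * - \<delta>)"
      using M\<delta> \<eta> by (intro mult_left_mono) auto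
    also have "\<dots> \<le> (1 + \<eta>) * (1 + - \<delta>) ^ (M * M)"
      using \<delta> \<eta> by (intro mult_left_mono Bernoulli_inequality) auto
    finally have \<eta>\<delta>: "1 \<le> (1 + \<eta>) * (1 - \<delta>) ^ (M * M)" by simp
    define \<gamma> where "\<gamma> = 1 / (4 * real M)"
    have \<gamma>: "0 < \<gamma>" using M by (simp add: \<gamma>_def)
    define c where "c = \<gamma> / - ln (1 - \<delta>)"
    have c: "0 < c" unfolding c_def using \<gamma> \<delta> by (intro divide_pos_pos) auto
    have ev1: "\<forall>\<^sub>F n in sequentially. 2 * real M * (c * ln (real n)) + 1 \<le>
        \<eta> * ((real n / real M - 1) * q * real n powr (- (1 / 2)))"
      using M q c \<eta>(1) by real_asymp
    have ev2: "\<forall>\<^sub>F n in sequentially. norm (ln (\<Prod>i=1..n. 1 - p i) / ln (real n) - 0) < \<gamma>"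
      using lim \<gamma> unfolding LIMSEQ_def eventually_sequentially dist_norm by blast
    have "\<forall>\<^sub>F n in sequentially. norm (measure_pmf.prob (random_graph n p)
        {E. \<exists>a. a + M \<le> n \<and> isolated_copy M H a E} - 1) < r"
      using ev1 ev2 eventually_ge_at_top[of 2]
    proof eventually_elim
      case (elim n)
      let ?W = "\<Prod>i=1..n. 1 - p i"
      let ?B = "real (card {d \<in> {1..n}. \<delta> < p d})"
      have W: "0 < ?W" using p by (intro prod_pos) auto
      have n: "0 < ln (real n)" using elim(3) by simp
      have lnW: "- \<gamma> * ln (real n) \<le> ln ?W"
        using elim(2) n by (simp add: abs_less_iff divide_less_eq less_divide_eq algebra_simps)
      have "?B * - ln (1 - \<delta>) \<le> \<gamma> * ln (real n)"
        using card_likely_distances[where p = p and n = n, OF p \<delta>] lnW by simp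
      then have B: "?B \<le> c * ln (real n)"
        using \<delta> by (simp add: c_def field_simps)
      have "real n powr (- (1 / 2)) = exp (2 * real M * (- \<gamma> * ln (real n)))"
        using elim(3) M by (simp add: powr_def \<gamma>_def)
      also have "\<dots> \<le> exp (2 * real M * ln ?W)"
        using mult_left_mono[OF lnW, of "2 * real M"] by simp
      also have "\<dots> = exp (real (2 * M) * ln ?W)" by simp
      also have "\<dots> = exp (ln ?W) ^ (2 * M)" by (rule exp_of_nat_mult)
      also have "\<dots> = ?W ^ (2 * M)" using W by simp
      finally have WM: "real n powr (- (1 / 2)) \<le> ?W ^ (2 * M)" .
      have nM: "real n / real M - 1 \<le> real (n div M)"
      proof -
        have "real n = real (n div M) * real M + real (n mod M)"
          by (metis div_mult_mod_eq of_nat_add of_nat_mult)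
        moreover have "real (n mod M) \<le> real M" using M by (simp add: less_imp_le)
        ultimately show ?thesis using M by (simp add: field_simps)
      qed
      have "2 * real M * ?B + 1 \<le> 2 * real M * (c * ln (real n)) + 1"
        using B by (simp add: mult_left_mono)
      also have "\<dots> \<le> \<eta> * ((real n / real M - 1) * q * real n powr (- (1 / 2)))"
        by (rule elim(1))
      also have "\<dots> \<le> \<eta> * (real (n div M) * q * real n powr (- (1 / 2)))"
        using nM q \<eta>(1) by (intro mult_left_mono mult_right_mono) auto
      also have "\<dots> \<le> \<eta> * (real (n div M) * q * ?W ^ (2 * M))"
        using WM q \<eta>(1) by (intro mult_left_mono) auto
      finally have "real (2 * M * card {d \<in> {1..n}. \<delta> < p d} + 1) \<le>
          \<eta> * (real (n div M) * q * ?W ^ (2 * M))"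
        by (simp only: of_nat_add of_nat_mult of_nat_numeral of_nat_1)
      then have "1 - 2 * \<eta> \<le> measure_pmf.prob (random_graph n p)
          {E. \<exists>a. a + M \<le> n \<and> isolated_copy M H a E}"
        using isolated_copy_likely[where p = p and n = n, OF p H M \<delta> \<eta>(1) \<eta>\<delta>] unfolding q_def by blast
      then show ?case
        using \<eta>(3) measure_pmf.prob_le_1[of "random_graph n p"] by (simp add: abs_less_iff)
    qed
    then show "\<exists>no. \<forall>n\<ge>no. norm (measure_pmf.prob (random_graph n p)
        {E. \<exists>a. a + M \<le> n \<and> isolated_copy M H a E} - 1) < r"
      by (simp add: eventually_sequentially)
  qed
qed

section \<open>The zero-one law\<close>

lemma zero_one_law:
  assumes p: "\<And>i. 1 \<le> i \<Longrightarrow> 0 \<le> p i \<and> p i < 1"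
    and lim: "(\<lambda>n. ln (\<Prod>i=1..n. 1 - p i) / ln (real n)) \<longlonglongrightarrow> 0"
    and \<psi>: "sentence \<psi>"
  shows "(\<lambda>n. Prob n p \<psi>) \<longlonglongrightarrow> 0 \<or> (\<lambda>n. Prob n p \<psi>) \<longlonglongrightarrow> 1"
proof -
  obtain M H where MH: "absorbing (qdepth \<psi>) p M H" using absorbing_exists by blast
  then have H: "possible p M H" by (simp add: absorbing_def)
  define Q where "Q n = {E. \<exists>a. a + M \<le> n \<and> isolated_copy M H a E}" for n
  have Q: "(\<lambda>n. measure_pmf.prob (random_graph n p) (Q n)) \<longlonglongrightarrow> 1"
    unfolding Q_def by (rule isolated_copy_tendsto[OF p lim H])
  have p': "\<And>i. 1 \<le> i \<Longrightarrow> 0 \<le> p i \<and> p i \<le> 1" using p by (meson less_imp_le)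
  have same: "models {1..n} E \<psi> \<longleftrightarrow> models {1..M} H \<psi>"
    if E: "E \<in> set_pmf (random_graph n p)" "E \<in> Q n" for n E
  proof -
    from E(2) obtain a where a: "isolated_copy M H a E" "a + M \<le> n" by (auto simp: Q_def)
    have "ef (qdepth \<psi>) {1..n} E {1..M} H {}"
      by (rule absorbing_isolated_copy[OF MH random_graph_possible[OF p' E(1)] a])
    then have "sat {1..n} E \<rho> \<psi> \<longleftrightarrow> sat {1..M} H \<rho> \<psi>" for \<rho>
      using \<psi> by (intro ef_sat_iff) (auto simp: sentence_def)
    then show ?thesis by (simp add: models_def)
  qed
  have le: "measure_pmf.prob (random_graph n p) X \<le> measure_pmf.prob (random_graph n p) Y"
    if "\<And>E. E \<in> set_pmf (random_graph n p) \<Longrightarrow> E \<in> X \<Longrightarrow> E \<in> Y" for n X Y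
  proof -
    have "measure_pmf.prob (random_graph n p) X =
        measure_pmf.prob (random_graph n p) (X \<inter> set_pmf (random_graph n p))"
      by (simp add: measure_Int_set_pmf)
    also have "\<dots> \<le> measure_pmf.prob (random_graph n p) Y"
      using that by (intro measure_pmf.finite_measure_mono) auto
    finally show ?thesis .
  qed
  show ?thesis
  proof (cases "models {1..M} H \<psi>")
    case True
    have lower: "measure_pmf.prob (random_graph n p) (Q n) \<le> Prob n p \<psi>" for n
      unfolding Prob_def using same True by (intro le) auto
    have upper: "Prob n p \<psi> \<le> 1" for n by (simp add: Prob_def)
    have "(\<lambda>n. Prob n p \<psi>) \<longlonglongrightarrow> 1"
      by (rule tendsto_sandwich[OF _ _ Q tendsto_const]) (simp_all add: lower upper)
    then show ?thesis ..
  next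
    case False
    have upper: "Prob n p \<psi> \<le> 1 - measure_pmf.prob (random_graph n p) (Q n)" for n
    proof -
      have "Prob n p \<psi> \<le> measure_pmf.prob (random_graph n p) (UNIV - Q n)"
        unfolding Prob_def using same False by (intro le) auto
      then show ?thesis using measure_pmf.prob_compl[of "Q n" "random_graph n p"] by simp
    qed
    have lim0: "(\<lambda>n. 1 - measure_pmf.prob (random_graph n p) (Q n)) \<longlonglongrightarrow> 0"
      using tendsto_diff[OF tendsto_const[of 1] Q] by simp
    have lower: "0 \<le> Prob n p \<psi>" for n by (simp add: Prob_def)
    have "(\<lambda>n. Prob n p \<psi>) \<longlonglongrightarrow> 0"
      by (rule tendsto_sandwich[OF _ _ tendsto_const lim0]) (simp_all add: lower upper)
    then show ?thesis ..
  qed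
qed

section \<open>A sentence that oscillates\<close>

text \<open>The empty conjunction is the valid formula \<open>Eq 0 0\<close>, so a conjunction always has the free variable \<open>0\<close>;
  this is harmless under quantifiers over \<open>0, \<dots>, K - 1\<close> with \<open>K > 0\<close>.\<close>

primrec conjunction :: "formula list \<Rightarrow> formula" where
  "conjunction [] = Eq 0 0"
| "conjunction (\<phi> # \<phi>s) = Conj \<phi> (conjunction \<phi>s)"

primrec exists_upto :: "nat \<Rightarrow> formula \<Rightarrow> formula" where
  "exists_upto 0 \<phi> = \<phi>"
| "exists_upto (Suc k) \<phi> = exists_upto k (Exists k \<phi>)"

lemma sat_conjunction [simp]: "sat V E \<rho> (conjunction \<phi>s) \<longleftrightarrow> (\<forall>\<phi>\<in>set \<phi>s. sat V E \<rho> \<phi>)"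
  by (induction \<phi>s) auto

lemma free_vars_conjunction: "free_vars (conjunction \<phi>s) = insert 0 (\<Union>\<phi>\<in>set \<phi>s. free_vars \<phi>)"
  by (induction \<phi>s) auto

lemma sat_exists_upto:
  "sat V E \<rho> (exists_upto k \<phi>) \<longleftrightarrow>
     (\<exists>f. (\<forall>i<k. f i \<in> V) \<and> sat V E (\<lambda>i. if i < k then f i else \<rho> i) \<phi>)"
proof (induction k arbitrary: \<phi>)
  case 0
  then show ?case by simp
next
  case (Suc k)
  show ?case unfolding exists_upto.simps Suc
  proof
    assume "\<exists>f. (\<forall>i<k. f i \<in> V) \<and> sat V E (\<lambda>i. if i < k then f i else \<rho> i) (Exists k \<phi>)"
    then obtain f v where f: "\<forall>i<k. f i \<in> V" "v \<in> V"
      "sat V E ((\<lambda>i. if i < k then f i else \<rho> i)(k := v)) \<phi>" by auto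
    moreover have "(\<lambda>i. if i < k then f i else \<rho> i)(k := v) =
        (\<lambda>i. if i < Suc k then (f(k := v)) i else \<rho> i)" by (auto simp: fun_eq_iff)
    ultimately show "\<exists>f. (\<forall>i<Suc k. f i \<in> V) \<and> sat V E (\<lambda>i. if i < Suc k then f i else \<rho> i) \<phi>"
      by (intro exI[of _ "f(k := v)"]) auto
  next
    assume "\<exists>f. (\<forall>i<Suc k. f i \<in> V) \<and> sat V E (\<lambda>i. if i < Suc k then f i else \<rho> i) \<phi>"
    then obtain f where f: "\<forall>i<Suc k. f i \<in> V" "sat V E (\<lambda>i. if i < Suc k then f i else \<rho> i) \<phi>"
      by auto
    moreover have "(\<lambda>i. if i < Suc k then f i else \<rho> i) = (\<lambda>i. if i < k then f i else \<rho> i)(k := f k)"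
      by (auto simp: fun_eq_iff)
    ultimately show "\<exists>f. (\<forall>i<k. f i \<in> V) \<and> sat V E (\<lambda>i. if i < k then f i else \<rho> i) (Exists k \<phi>)"
      by (intro exI[of _ f]) auto
  qed
qed

lemma free_vars_exists_upto: "free_vars (exists_upto k \<phi>) = free_vars \<phi> - {..<k}"
  by (induction k arbitrary: \<phi>) (auto simp: less_Suc_eq)

text \<open>The variables \<open>0, \<dots>, K - 1\<close> are the vertices of a clique; the variable \<open>K\<close> runs over the
  vertices outside it, none of which may be adjacent to the clique.\<close>

definition isolated_clique :: "nat \<Rightarrow> formula" where
  "isolated_clique K = exists_upto K (Conj
     (conjunction [Adj i j. i \<leftarrow> [0..<K], j \<leftarrow> [0..<K], i \<noteq> j])
     (Neg (Exists K (Conj (conjunction (map (\<lambda>j. Neg (Eq K j)) [0..<K]))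
        (Neg (conjunction (map (\<lambda>i. Neg (Adj K i)) [0..<K])))))))"

lemma sentence_isolated_clique:
  assumes "0 < K"
  shows "sentence (isolated_clique K)"
proof -
  have closed: "X \<union> ((Y \<union> Z) - {K}) - {..<K} = {}"
    if "X \<subseteq> {..<K}" "Y \<subseteq> {..K}" "Z \<subseteq> {..K}" for X Y Z
    using that by (auto simp: subset_iff)
  have x: "free_vars (conjunction [Adj i j. i \<leftarrow> [0..<K], j \<leftarrow> [0..<K], i \<noteq> j]) \<subseteq> {..<K}"
    using assms unfolding free_vars_conjunction by (auto split: if_splits)
  have y: "free_vars (conjunction (map (\<lambda>j. Neg (Eq K j)) [0..<K])) \<subseteq> {..K}"
    using assms unfolding free_vars_conjunction by auto
  have z: "free_vars (conjunction (map (\<lambda>i. Neg (Adj K i)) [0..<K])) \<subseteq> {..K}"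
    using assms unfolding free_vars_conjunction by auto
  show ?thesis
    unfolding sentence_def isolated_clique_def free_vars_exists_upto free_vars.simps by (rule closed[OF x y z])
qed

lemma models_isolated_clique_iff:
  "models V E (isolated_clique K) \<longleftrightarrow>
     (\<exists>f. (\<forall>i<K. f i \<in> V) \<and> (\<forall>i<K. \<forall>j<K. i \<noteq> j \<longrightarrow> {f i, f j} \<in> E) \<and>
       (\<forall>y\<in>V. \<forall>i<K. {y, f i} \<in> E \<longrightarrow> (\<exists>j<K. y = f j)))"
proof -
  have "sat V E \<rho> (isolated_clique K) \<longleftrightarrow>
     (\<exists>f. (\<forall>i<K. f i \<in> V) \<and> (\<forall>i<K. \<forall>j<K. i \<noteq> j \<longrightarrow> {f i, f j} \<in> E) \<and>
       (\<forall>y\<in>V. \<forall>i<K. {y, f i} \<in> E \<longrightarrow> (\<exists>j<K. y = f j)))" for \<rho>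
  proof -
    define \<sigma> where "\<sigma> f = (\<lambda>i. if i < K then f i else \<rho> i)" for f
    have adj: "sat V E (\<sigma> f) (conjunction [Adj i j. i \<leftarrow> [0..<K], j \<leftarrow> [0..<K], i \<noteq> j]) \<longleftrightarrow>
        (\<forall>i<K. \<forall>j<K. i \<noteq> j \<longrightarrow> {f i, f j} \<in> E)" for f
      by (auto simp: \<sigma>_def)
    have eq: "sat V E ((\<sigma> f)(K := y)) (conjunction (map (\<lambda>j. Neg (Eq K j)) [0..<K])) \<longleftrightarrow>
        (\<forall>j<K. y \<noteq> f j)" for f y
      by (auto simp: \<sigma>_def)
    have nonadj: "sat V E ((\<sigma> f)(K := y)) (conjunction (map (\<lambda>i. Neg (Adj K i)) [0..<K])) \<longleftrightarrow>
        (\<forall>i<K. {y, f i} \<notin> E)" for f y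
      by (auto simp: \<sigma>_def)
    show ?thesis
      unfolding isolated_clique_def sat_exists_upto \<sigma>_def[symmetric] sat.simps(3-5) adj eq nonadj
      by (intro arg_cong[where f = Ex] ext conj_cong refl) blast
  qed
  then show ?thesis by (simp add: models_def)
qed

lemma models_isolated_clique_if_copy:
  assumes iso: "isolated_copy K (vertex_pairs K) a E" and a: "a + K \<le> n"
  shows "models {1..n} E (isolated_clique K)"
  unfolding models_isolated_clique_iff
proof (intro exI[of _ "\<lambda>i. a + (i + 1)"] conjI allI impI ballI)
  let ?f = "\<lambda>i. a + (i + 1)"
  have mem: "{?f i, y} \<in> E \<longleftrightarrow> {?f i, y} \<in> shift a (vertex_pairs K)" if "i < K" for i y
    using isolated_copy_pair_iff[OF iso, of "i + 1"] that by simp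
  show "?f i \<in> {1..n}" if "i < K" for i using a that by auto
  show "{?f i, ?f j} \<in> E" if "i < K" "j < K" "i \<noteq> j" for i j
    unfolding mem[OF that(1)] shift_pair_iff using that by simp
  show "\<exists>j<K. y = ?f j" if "y \<in> {1..n}" "i < K" "{y, ?f i} \<in> E" for y i
  proof -
    have "{?f i, y} \<in> shift a (vertex_pairs K)"
      using that(3) mem[OF that(2), of y] by (simp add: insert_commute)
    then have "a < y \<and> y \<le> a + K" by (rule in_shift_bounds) auto
    then show ?thesis by (intro exI[of _ "y - a - 1"]) auto
  qed
qed

lemma models_isolated_cliqueD:
  assumes "models {1..n} E (isolated_clique K)" "E \<subseteq> vertex_pairs n"
  obtains A where "A \<subseteq> {1..n}" "card A = K" "\<And>x y. x \<in> A \<Longrightarrow> y \<in> A \<Longrightarrow> x \<noteq> y \<Longrightarrow> {x, y} \<in> E"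
    "\<And>x y. x \<in> A \<Longrightarrow> y \<in> {1..n} - A \<Longrightarrow> {x, y} \<notin> E"
proof -
  obtain f where f0: "\<forall>i<K. f i \<in> {1..n}" "\<forall>i<K. \<forall>j<K. i \<noteq> j \<longrightarrow> {f i, f j} \<in> E"
    "\<forall>y\<in>{1..n}. \<forall>i<K. {y, f i} \<in> E \<longrightarrow> (\<exists>j<K. y = f j)"
    using assms(1) unfolding models_isolated_clique_iff by (elim exE conjE)
  have f: "f i \<in> {1..n}" "j < K \<Longrightarrow> i \<noteq> j \<Longrightarrow> {f i, f j} \<in> E"
    "y \<in> {1..n} \<Longrightarrow> {y, f i} \<in> E \<Longrightarrow> \<exists>j<K. y = f j" if "i < K" for i j y
    using f0 that by blast+
  have "inj_on f {..<K}"
  proof (rule inj_onI, rule ccontr)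
    fix i j assume "i \<in> {..<K}" "j \<in> {..<K}" "f i = f j" "i \<noteq> j"
    then have "{f i} \<in> vertex_pairs n" using f(2)[of i j] assms(2) by auto
    then show False by (simp add: vertex_pairs_def)
  qed
  then have c1: "card (f ` {..<K}) = K" by (simp add: card_image)
  have c2: "f ` {..<K} \<subseteq> {1..n}" using f(1) by auto
  have c3: "{x, y} \<in> E" if "x \<in> f ` {..<K}" "y \<in> f ` {..<K}" "x \<noteq> y" for x y
    using that f(2) by auto
  have c4: "{x, y} \<notin> E" if "x \<in> f ` {..<K}" "y \<in> {1..n} - f ` {..<K}" for x y
  proof
    assume edge: "{x, y} \<in> E"
    from that(1) obtain i where i: "i < K" "x = f i" by blast
    then have "{y, f i} \<in> E" using edge by (simp add: insert_commute)
    then show False using f(3)[OF i(1), of y] that(2) by blast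
  qed
  show ?thesis by (rule that[OF c2 c1 c3 c4])
qed

text \<open>The set \<open>N\<close> holds the jump distances, where an edge is missing with probability only
  \<open>d powr - \<epsilon>\<close>.\<close>

definition jump_probs :: "real \<Rightarrow> nat \<Rightarrow> nat set \<Rightarrow> nat \<Rightarrow> real" where
  "jump_probs \<epsilon> K N d = (if d < K then 1 / 2 else if d \<in> N then 1 - real d powr - \<epsilon> else 0)"

lemma jump_probs_bounds:
  assumes "0 < \<epsilon>" "1 \<le> d"
  shows "0 \<le> jump_probs \<epsilon> K N d \<and> jump_probs \<epsilon> K N d < 1"
proof -
  have "real d powr - \<epsilon> \<le> 1"
    using assms powr_mono[of "- \<epsilon>" 0 "real d"] by simp
  then show ?thesis using assms by (simp add: jump_probs_def)
qed

lemma jump_probs_le: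
  assumes "0 < \<epsilon>" "1 \<le> d"
  shows "0 \<le> jump_probs \<epsilon> K N d \<and> jump_probs \<epsilon> K N d \<le> 1"
  using jump_probs_bounds[OF assms] by (meson less_imp_le)

lemma Prob_cong:
  assumes "\<And>d. 1 \<le> d \<Longrightarrow> d < n \<Longrightarrow> p d = q d"
  shows "Prob n p \<psi> = Prob n q \<psi>"
proof -
  have "p (Max e - Min e) = q (Max e - Min e)" if "e \<in> vertex_pairs n" for e
    using that by (elim vertex_pairsE) (auto intro!: assms)
  then have "random_graph n p = random_graph n q"
    unfolding random_graph_def by (intro arg_cong[where f = "map_pmf _"] Pi_pmf_cong) auto
  then show ?thesis by (simp add: Prob_def)
qed

text \<open>With finitely many jumps the product over the distances is eventually constant, so isolated
  copies of every graph of positive probability appear, in particular of the complete graph on \<open>K\<close>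
  consecutive vertices.\<close>

lemma clique_likely_finite:
  assumes \<epsilon>: "0 < \<epsilon>" and N: "finite N"
  shows "(\<lambda>n. Prob n (jump_probs \<epsilon> K N) (isolated_clique K)) \<longlonglongrightarrow> 1"
proof -
  define p where "p = jump_probs \<epsilon> K N"
  have p: "0 \<le> p i \<and> p i < 1" if "1 \<le> i" for i
    unfolding p_def by (rule jump_probs_bounds[OF \<epsilon> that])
  obtain R where R: "\<And>d. R < d \<Longrightarrow> p d = 0"
  proof -
    have "finite ({..<K} \<union> N)" using N by simp
    then obtain R where "\<forall>d\<in>{..<K} \<union> N. d \<le> R" using finite_nat_set_iff_bounded_le by blast
    then show thesis by (intro that[of R]) (force simp: p_def jump_probs_def)
  qed
  have const: "(\<Prod>i=1..n. 1 - p i) = (\<Prod>i=1..R. 1 - p i)" if "R \<le> n" for n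
    using that R by (intro prod.mono_neutral_right) auto
  have "(\<lambda>n. c / ln (real n)) \<longlonglongrightarrow> 0" for c :: real
    by real_asymp
  then have "(\<lambda>n. ln (\<Prod>i=1..R. 1 - p i) / ln (real n)) \<longlonglongrightarrow> 0" .
  moreover have "\<forall>\<^sub>F n in sequentially. ln (\<Prod>i=1..R. 1 - p i) / ln (real n) =
      ln (\<Prod>i=1..n. 1 - p i) / ln (real n)"
    using eventually_ge_at_top[of R]
  proof eventually_elim
    case (elim n)
    show ?case unfolding const[OF elim] ..
  qed
  ultimately have lim: "(\<lambda>n. ln (\<Prod>i=1..n. 1 - p i) / ln (real n)) \<longlonglongrightarrow> 0"
    by (rule Lim_transform_eventually)
  have "possible p K (vertex_pairs K)"
    by (auto simp: possible_def p_def jump_probs_def elim!: vertex_pairsE)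
  from isolated_copy_tendsto[OF p lim this]
  have copies: "(\<lambda>n. measure_pmf.prob (random_graph n p)
      {E. \<exists>a. a + K \<le> n \<and> isolated_copy K (vertex_pairs K) a E}) \<longlonglongrightarrow> 1" by simp
  have lower: "measure_pmf.prob (random_graph n p)
      {E. \<exists>a. a + K \<le> n \<and> isolated_copy K (vertex_pairs K) a E} \<le> Prob n p (isolated_clique K)" for n
    unfolding Prob_def using models_isolated_clique_if_copy
    by (intro measure_pmf.finite_measure_mono) auto
  have upper: "Prob n p (isolated_clique K) \<le> 1" for n by (simp add: Prob_def)
  have "(\<lambda>n. Prob n p (isolated_clique K)) \<longlonglongrightarrow> 1"
    by (rule tendsto_sandwich[OF _ _ copies tendsto_const]) (simp_all add: lower upper)
  then show ?thesis by (simp add: p_def)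
qed

text \<open>The next jump is put so far out that on \<open>s j\<close> vertices the graph with the earlier jumps alone
  already satisfies the sentence with probability close to \<open>1\<close>.\<close>

lemma jump_sequence:
  assumes \<epsilon>: "0 < \<epsilon>"
  obtains s :: "nat \<Rightarrow> nat" where "\<And>j. 2 * K + 2 < s j" "\<And>j. s j ^ 2 \<le> s (Suc j)"
    "\<And>j. 1 - 1 / real (Suc j) \<le> Prob (s j) (jump_probs \<epsilon> K (s ` {..<j})) (isolated_clique K)"
proof -
  let ?P = "\<lambda>N n. Prob n (jump_probs \<epsilon> K N) (isolated_clique K)"
  have large: "\<exists>n\<ge>m. 1 - 1 / real (Suc j) \<le> ?P N n" if "finite N" for N m j
  proof -
    have "\<forall>\<^sub>F n in sequentially. 1 - 1 / real (Suc j) < ?P N n"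
      using clique_likely_finite[OF \<epsilon> that] by (rule order_tendstoD) simp
    then have "\<forall>\<^sub>F n in sequentially. m \<le> n \<and> 1 - 1 / real (Suc j) < ?P N n"
      using eventually_ge_at_top[of m] by eventually_elim simp
    then obtain n where "m \<le> n" "1 - 1 / real (Suc j) < ?P N n"
      unfolding eventually_sequentially by blast
    then show ?thesis using less_imp_le by blast
  qed
  \<comment> \<open>A state pairs the set of earlier jumps with the next jump.\<close>
  have "\<exists>f. \<forall>j. (finite (fst (f j)) \<and> 2 * K + 2 < snd (f j) \<and>
        1 - 1 / real (Suc j) \<le> ?P (fst (f j)) (snd (f j)) \<and> (j = 0 \<longrightarrow> fst (f j) = {})) \<and>
      (fst (f (Suc j)) = insert (snd (f j)) (fst (f j)) \<and> snd (f j) ^ 2 \<le> snd (f (Suc j)))"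
  proof (rule dependent_nat_choice)
    obtain n where "2 * K + 3 \<le> n" "1 - 1 / real (Suc 0) \<le> ?P {} n"
      using large[of "{}" "2 * K + 3" 0] by auto
    then show "\<exists>x. finite (fst x) \<and> 2 * K + 2 < snd x \<and>
        1 - 1 / real (Suc 0) \<le> ?P (fst x) (snd x) \<and> ((0 :: nat) = 0 \<longrightarrow> fst x = {})"
      by (intro exI[of _ "({}, n)"]) auto
  next
    fix x j assume x: "finite (fst x) \<and> 2 * K + 2 < snd x \<and>
        1 - 1 / real (Suc j) \<le> ?P (fst x) (snd x) \<and> (j = 0 \<longrightarrow> fst x = {})"
    obtain n where n: "2 * K + 3 + snd x ^ 2 \<le> n" "1 - 1 / real (Suc (Suc j)) \<le> ?P (insert (snd x) (fst x)) n"
      using large[of "insert (snd x) (fst x)" "2 * K + 3 + snd x ^ 2" "Suc j"] x by auto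
    then show "\<exists>y. (finite (fst y) \<and> 2 * K + 2 < snd y \<and>
        1 - 1 / real (Suc (Suc j)) \<le> ?P (fst y) (snd y) \<and> (Suc j = 0 \<longrightarrow> fst y = {})) \<and>
      (fst y = insert (snd x) (fst x) \<and> snd x ^ 2 \<le> snd y)"
      using x by (intro exI[of _ "(insert (snd x) (fst x), n)"]) auto
  qed
  then obtain f where f0: "\<forall>j. (finite (fst (f j)) \<and> 2 * K + 2 < snd (f j) \<and>
        1 - 1 / real (Suc j) \<le> ?P (fst (f j)) (snd (f j)) \<and> (j = 0 \<longrightarrow> fst (f j) = {})) \<and>
      (fst (f (Suc j)) = insert (snd (f j)) (fst (f j)) \<and> snd (f j) ^ 2 \<le> snd (f (Suc j)))"
    by (elim exE)
  have f: "2 * K + 2 < snd (f j)" "1 - 1 / real (Suc j) \<le> ?P (fst (f j)) (snd (f j))"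
    "fst (f 0) = {}" "fst (f (Suc j)) = insert (snd (f j)) (fst (f j))"
    "snd (f j) ^ 2 \<le> snd (f (Suc j))" for j
    using f0[rule_format, of j] f0[rule_format, of 0] by simp_all
  have history: "fst (f j) = (snd \<circ> f) ` {..<j}" for j
    by (induction j) (simp_all add: f(3,4) lessThan_Suc)
  show thesis
    by (rule that[of "snd \<circ> f"]) (simp_all only: comp_apply f(1,5) f(2)[unfolded history])
qed

text \<open>The extreme vertices of the clique are at the largest distance, which is the sum of their
  distances to a third vertex. A jump distance is more than twice every smaller admissible distance
  and so is never such a sum. Hence the clique has diameter below \<open>K\<close> and fills an interval.\<close>

lemma clique_positions:
  assumes K: "3 \<le> K" and A: "card A = K"
    and dist: "\<And>x y. x \<in> A \<Longrightarrow> y \<in> A \<Longrightarrow> x < y \<Longrightarrow> y - x < K \<or> y - x \<in> N"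
    and gap: "\<And>u w. u < K \<or> u \<in> N \<Longrightarrow> w \<in> N \<Longrightarrow> u < w \<Longrightarrow> 2 * u < (w :: nat)"
  shows "A = {Min A..<Min A + K}"
proof -
  have fin: "finite A" and ne: "A \<noteq> {}" using K A card.infinite by fastforce+
  define x where "x = Min A"
  define z where "z = Max A"
  have xz: "x \<in> A" "z \<in> A" using fin ne by (auto simp: x_def z_def)
  have bounds: "x \<le> y \<and> y \<le> z" if "y \<in> A" for y using that fin by (auto simp: x_def z_def)
  have "z - x < K"
  proof (rule ccontr)
    assume far: "\<not> z - x < K"
    then have xz_less: "x < z" using K by auto
    have "z - x \<in> N" using dist[OF xz xz_less] far by blast
    have "card {x, z} < card A" using A K by (simp add: card_insert_if)
    then have "\<not> A \<subseteq> {x, z}" by (metis card_mono finite.emptyI finite_insert not_less)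
    then obtain y where y: "y \<in> A" "y \<noteq> x" "y \<noteq> z" by blast
    then have "x < y" "y < z" using bounds[of y] by auto
    have "2 * (y - x) < z - x" "2 * (z - y) < z - x"
      using gap[OF dist[OF xz(1) y(1) \<open>x < y\<close>] \<open>z - x \<in> N\<close>]
        gap[OF dist[OF y(1) xz(2) \<open>y < z\<close>] \<open>z - x \<in> N\<close>] \<open>x < y\<close> \<open>y < z\<close> by auto
    then show False using \<open>x < y\<close> \<open>y < z\<close> by linarith
  qed
  then have "A \<subseteq> {x..<x + K}" using bounds by fastforce
  then have "A = {x..<x + K}" using A by (intro card_subset_eq) auto
  then show ?thesis by (simp add: x_def)
qed

text \<open>On \<open>2 * m\<close> vertices each vertex has a partner at distance \<open>m\<close>. An isolated clique is a block,
  and its \<open>K\<close> partner pairs are distinct and all absent, which has probability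
  \<open>m powr (- \<epsilon> * K)\<close>; at most \<open>2 * m\<close> blocks are possible.\<close>

lemma clique_unlikely:
  fixes m :: nat
  assumes \<epsilon>: "0 < \<epsilon>" and K: "3 \<le> K" "2 \<le> \<epsilon> * real K" and m: "m \<in> N" "K < m"
    and gap: "\<And>u w. u < K \<or> u \<in> N \<Longrightarrow> w \<in> N \<Longrightarrow> u < w \<Longrightarrow> 2 * u < w"
  shows "Prob (2 * m) (jump_probs \<epsilon> K N) (isolated_clique K) \<le> 2 / real m"
proof -
  define p where "p = jump_probs \<epsilon> K N"
  let ?P = "measure_pmf.prob (random_graph (2 * m) p)"
  have p: "0 \<le> p i \<and> p i \<le> 1" if "1 \<le> i" for i
    unfolding p_def by (rule jump_probs_le[OF \<epsilon> that])
  define partner where "partner i = (if i \<le> m then i + m else i - m)" for i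
  define cut where "cut a = (\<lambda>i. {i, partner i}) ` block K a" for a
  define B where "B a = {E. \<forall>e\<in>cut a. e \<in> E \<longleftrightarrow> e \<in> {}}" for a
  have PB: "?P (B a) \<le> real m powr - 2" if a: "a + K \<le> 2 * m" for a
  proof -
    have sub: "cut a \<subseteq> vertex_pairs (2 * m)"
      using a m by (auto simp: cut_def block_def partner_def)
    have inj: "inj_on (\<lambda>i. {i, partner i}) (block K a)"
      using m(2) by (intro inj_onI) (auto simp: doubleton_eq_iff block_def partner_def split: if_splits)
    have "weight p {} {i, partner i} = real m powr - \<epsilon>" for i
      using m by (auto simp: weight_def partner_def p_def jump_probs_def)
    then have "(\<Prod>e\<in>cut a. weight p {} e) = (real m powr - \<epsilon>) ^ K"
      unfolding cut_def prod.reindex[OF inj] by (simp add: block_def)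
    then have "?P (B a) = (real m powr - \<epsilon>) ^ K"
      unfolding B_def using prob_edge_pattern[where p = p and S = "{}", OF p sub] by simp
    also have "\<dots> = real m powr (- \<epsilon> * real K)"
      using m by (simp add: powr_power mult.commute)
    also have "\<dots> \<le> real m powr - 2"
      using K m by (intro powr_mono) auto
    finally show ?thesis .
  qed
  have "\<exists>a. a + K \<le> 2 * m \<and> E \<in> B a"
    if E: "E \<in> set_pmf (random_graph (2 * m) p)" and mod: "models {1..2 * m} E (isolated_clique K)" for E
  proof -
    have poss: "possible p (2 * m) E" by (rule random_graph_possible[OF p E])
    then have "E \<subseteq> vertex_pairs (2 * m)" by (simp add: possible_def)
    from models_isolated_cliqueD[OF mod this]
    obtain A where A: "A \<subseteq> {1..2 * m}" "card A = K"
      "\<And>x y. x \<in> A \<Longrightarrow> y \<in> A \<Longrightarrow> x \<noteq> y \<Longrightarrow> {x, y} \<in> E"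
      "\<And>x y. x \<in> A \<Longrightarrow> y \<in> {1..2 * m} - A \<Longrightarrow> {x, y} \<notin> E" by blast
    have "y - x < K \<or> y - x \<in> N" if "x \<in> A" "y \<in> A" "x < y" for x y
    proof -
      have "{x, y} \<in> E" using A(3) that by simp
      then have "0 < p (Max {x, y} - Min {x, y})" using poss by (auto simp: possible_def)
      then have "0 < p (y - x)" using that(3) by (simp add: max_def min_def)
      then show ?thesis by (auto simp: p_def jump_probs_def split: if_splits)
    qed
    then have Aeq: "A = {Min A..<Min A + K}"
      by (rule clique_positions[OF K(1) A(2)]) (use gap in auto)
    define a where "a = Min A - 1"
    have "finite A" "A \<noteq> {}" using A(2) K(1) card.infinite by fastforce+
    then have "1 \<le> Min A" using A(1) by auto
    then have Ablock: "A = block K a"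
      by (subst Aeq) (auto simp: a_def block_def)
    have "a + K \<in> A" unfolding Ablock using K(1) by (auto simp: block_def)
    then have le: "a + K \<le> 2 * m" using A(1) by auto
    have "{i, partner i} \<notin> E" if "i \<in> block K a" for i
    proof -
      have i: "i \<in> A" "i \<in> {1..2 * m}" using that A(1) Ablock by auto
      have "partner i \<in> {1..2 * m} - A"
        using i that m(2) unfolding Ablock by (auto simp: partner_def block_def)
      then show ?thesis using A(4) i by blast
    qed
    then have "E \<in> B a" by (auto simp: B_def cut_def)
    then show ?thesis using le by blast
  qed
  then have "{E. models {1..2 * m} E (isolated_clique K)} \<inter> set_pmf (random_graph (2 * m) p)
      \<subseteq> (\<Union>a\<in>{a. a + K \<le> 2 * m}. B a)" by blast
  then have "Prob (2 * m) p (isolated_clique K) \<le> ?P (\<Union>a\<in>{a. a + K \<le> 2 * m}. B a)"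
    unfolding Prob_def measure_Int_set_pmf[symmetric, of "random_graph (2 * m) p" "{E. models {1..2 * m} E _}"]
    by (intro measure_pmf.finite_measure_mono) auto
  also have "\<dots> \<le> (\<Sum>a\<in>{a. a + K \<le> 2 * m}. ?P (B a))"
    by (intro measure_UNION_le) (auto intro: finite_subset[of _ "{..2 * m}"])
  also have "\<dots> \<le> (\<Sum>a\<in>{a. a + K \<le> 2 * m}. real m powr - 2)"
    using PB by (intro sum_mono) auto
  also have "\<dots> = real (card {a. a + K \<le> 2 * m}) * real m powr - 2" by simp
  also have "\<dots> \<le> real (2 * m) * real m powr - 2"
  proof -
    have "{a. a + K \<le> 2 * m} \<subseteq> {..<2 * m}" using K(1) by auto
    from card_mono[OF _ this] have "card {a. a + K \<le> 2 * m} \<le> 2 * m" by simp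
    then show ?thesis by (intro mult_right_mono) auto
  qed
  also have "\<dots> = 2 / real m"
  proof -
    have "real m powr - 2 = 1 / (real m * real m)"
      using m by (simp add: powr_minus_divide power2_eq_square)
    then show ?thesis using m by simp
  qed
  finally show ?thesis by (simp add: p_def)
qed

text \<open>Each jump is at least the square of the one before, so the jumps up to \<open>s j\<close> have a product of
  at most \<open>(s j)\<^sup>2\<close>.\<close>

lemma jump_probs_product_ge:
  assumes \<epsilon>: "0 < \<epsilon>" and s: "\<And>j. 2 * K + 2 < s j" "\<And>j. s j ^ 2 \<le> s (Suc j)"
    and mono: "strict_mono s" and n: "s 0 \<le> n"
  shows "(1 / 2) ^ K * real n powr (- 2 * \<epsilon>) \<le> (\<Prod>i=1..n. 1 - jump_probs \<epsilon> K (range s) i)"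
proof -
  define p where "p = jump_probs \<epsilon> K (range s)"
  have p: "0 \<le> p i \<and> p i \<le> 1" if "1 \<le> i" for i
    unfolding p_def by (rule jump_probs_le[OF \<epsilon> that])
  have pos: "0 < s j" for j using s(1)[of j] by simp
  have partial: "real (s j) powr (- 2 * \<epsilon>) \<le> (\<Prod>i\<le>j. real (s i) powr - \<epsilon>)" for j
  proof (induction j)
    case 0
    then show ?case using pos[of 0] \<epsilon> by (simp add: powr_mono)
  next
    case (Suc j)
    have "real (s (Suc j)) powr - \<epsilon> \<le> (real (s j) ^ 2) powr - \<epsilon>"
    proof (rule powr_mono2')
      show "real (s j) ^ 2 \<le> real (s (Suc j))"
        using s(2)[of j] by (metis of_nat_le_iff of_nat_power)
    qed (use \<epsilon> pos[of j] in auto)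
    also have "real (s j) ^ 2 = real (s j) powr 2"
      using pos[of j] by simp
    also have "(real (s j) powr 2) powr - \<epsilon> = real (s j) powr (- 2 * \<epsilon>)"
      by (simp only: powr_powr) simp
    also have "\<dots> \<le> (\<Prod>i\<le>j. real (s i) powr - \<epsilon>)" by (rule Suc.IH)
    finally have "real (s (Suc j)) powr - \<epsilon> * real (s (Suc j)) powr - \<epsilon> \<le>
        (\<Prod>i\<le>j. real (s i) powr - \<epsilon>) * real (s (Suc j)) powr - \<epsilon>"
      by (intro mult_right_mono) auto
    then show ?case by (simp flip: powr_add)
  qed
  \<comment> \<open>The jumps up to \<open>n\<close> are exactly \<open>s 0, \<dots>, s j\<close> with \<open>k = j + 1\<close>.\<close>
  define k where "k = (LEAST k. n < s k)"
  have k: "n < s k" "\<And>i. n < s i \<Longrightarrow> k \<le> i"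
  proof -
    have "n < s (Suc n)" using strict_mono_imp_increasing[OF mono, of "Suc n"] by simp
    then show "n < s k" unfolding k_def by (rule LeastI)
  qed (simp add: k_def Least_le)
  have "k \<noteq> 0" using k(1) n by (cases k) auto
  then obtain j where j: "k = Suc j" by (cases k) auto
  have sj: "s j \<le> n" using k(2)[of j] j by force
  have "real n powr (- 2 * \<epsilon>) \<le> real (s j) powr (- 2 * \<epsilon>)"
    using sj pos[of j] \<epsilon> by (intro powr_mono2') auto
  also have "\<dots> \<le> (\<Prod>i\<le>j. real (s i) powr - \<epsilon>)" by (rule partial)
  also have "\<dots> = (\<Prod>i\<in>{..j}. 1 - p (s i))"
  proof (rule prod.cong)
    fix i
    have "\<not> s i < K" using s(1)[of i] by simp
    then show "real (s i) powr - \<epsilon> = 1 - p (s i)" by (simp add: p_def jump_probs_def)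
  qed simp
  also have "\<dots> = (\<Prod>d\<in>s ` {..j}. 1 - p d)"
    using mono by (subst prod.reindex) (auto intro: strict_mono_imp_inj_on inj_on_subset)
  finally have "real n powr (- 2 * \<epsilon>) \<le> (\<Prod>d\<in>s ` {..j}. 1 - p d)" .
  moreover have "(1 / 2) ^ K \<le> (\<Prod>d\<in>{1..<K}. 1 - p d)"
  proof -
    have "(1 / 2 :: real) ^ K \<le> (1 / 2) ^ (K - 1)" by (rule power_decreasing) auto
    also have "\<dots> = (\<Prod>d\<in>{1..<K}. 1 - p d)" by (simp add: p_def jump_probs_def)
    finally show ?thesis .
  qed
  ultimately have "(1 / 2) ^ K * real n powr (- 2 * \<epsilon>) \<le>
      (\<Prod>d\<in>{1..<K}. 1 - p d) * (\<Prod>d\<in>s ` {..j}. 1 - p d)"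
    by (intro mult_mono) (auto intro: order_trans[of 0 "(1 / 2) ^ K"])
  also have "\<dots> = (\<Prod>d\<in>{1..<K} \<union> s ` {..j}. 1 - p d)"
  proof (rule prod.union_disjoint[symmetric])
    have "K \<le> s i" for i using s(1)[of i] by simp
    then show "{1..<K} \<inter> s ` {..j} = {}" by (auto simp: not_less[symmetric])
  qed auto
  also have "\<dots> \<le> (\<Prod>d\<in>{1..n} \<inter> ({1..<K} \<union> s ` {..j}). 1 - p d)"
    using p pos by (intro prod_antimono) (auto simp: Suc_le_eq)
  also have "\<dots> = (\<Prod>d\<in>{1..n}. 1 - p d)"
  proof (rule prod.mono_neutral_left)
    show "\<forall>d\<in>{1..n} - {1..n} \<inter> ({1..<K} \<union> s ` {..j}). 1 - p d = 1"
    proof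
      fix d assume d: "d \<in> {1..n} - {1..n} \<inter> ({1..<K} \<union> s ` {..j})"
      have "d \<notin> range s"
      proof
        assume "d \<in> range s"
        then obtain i where i: "d = s i" by blast
        then have "s i < s (Suc j)" using d k(1) j by auto
        then have "i \<le> j" using mono by (simp add: strict_mono_less)
        then show False using d i by auto
      qed
      then show "1 - p d = 1" using d by (auto simp: p_def jump_probs_def)
    qed
  qed auto
  finally show ?thesis by (simp add: p_def)
qed

lemma liminf_eq_0_of_subsequence:
  fixes f :: "nat \<Rightarrow> real"
  assumes "\<And>n. 0 \<le> f n" "strict_mono r" "(\<lambda>n. f (r n)) \<longlonglongrightarrow> 0"
  shows "liminf (\<lambda>n. ereal (f n)) = 0"
proof (rule antisym)
  have "liminf (\<lambda>n. ereal (f n)) \<le> liminf ((\<lambda>n. ereal (f n)) \<circ> r)"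
    by (rule liminf_subseq_mono[OF assms(2)])
  also have "\<dots> = 0"
    using assms(3) by (intro lim_imp_Liminf) (auto simp: comp_def zero_ereal_def)
  finally show "liminf (\<lambda>n. ereal (f n)) \<le> 0" .
  show "0 \<le> liminf (\<lambda>n. ereal (f n))"
    by (intro Liminf_bounded always_eventually) (simp add: assms(1))
qed

lemma limsup_eq_1_of_subsequence:
  fixes f :: "nat \<Rightarrow> real"
  assumes "\<And>n. f n \<le> 1" "strict_mono r" "(\<lambda>n. f (r n)) \<longlonglongrightarrow> 1"
  shows "limsup (\<lambda>n. ereal (f n)) = 1"
proof (rule antisym)
  show "limsup (\<lambda>n. ereal (f n)) \<le> 1"
    by (intro Limsup_bounded always_eventually) (simp add: assms(1))
  have "1 = limsup ((\<lambda>n. ereal (f n)) \<circ> r)"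
    using assms(3) by (intro lim_imp_Limsup[symmetric]) (auto simp: comp_def one_ereal_def)
  also have "\<dots> \<le> limsup (\<lambda>n. ereal (f n))"
    by (rule limsup_subseq_mono[OF assms(2)])
  finally show "1 \<le> limsup (\<lambda>n. ereal (f n))" .
qed

lemma oscillation:
  fixes \<epsilon> :: real
  assumes "0 < \<epsilon>"
  shows "\<exists>(p :: nat \<Rightarrow> real) \<psi>.
         (\<forall>i\<ge>1. 0 \<le> p i \<and> p i \<le> 1) \<and>
         sentence \<psi> \<and>
         (\<forall>\<^sub>F n in sequentially.
            (\<Prod>i=1..n. 1 - p i) > 0 \<and>
            - (ln (\<Prod>i=1..n. 1 - p i) / ln (real n)) < \<epsilon>) \<and>
         liminf (\<lambda>n. ereal (Prob n p \<psi>)) = 0 \<and>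
         limsup (\<lambda>n. ereal (Prob n p \<psi>)) = 1"
proof -
  \<comment> \<open>The jumps cost \<open>2 * \<delta> = \<epsilon> / 2\<close>; the other half of \<open>\<epsilon>\<close> pays for the distances below \<open>K\<close>.\<close>
  define \<delta> where "\<delta> = \<epsilon> / 4"
  have \<delta>: "0 < \<delta>" using assms by (simp add: \<delta>_def)
  define K where "K = max 3 (nat \<lceil>2 / \<delta>\<rceil>)"
  have K: "3 \<le> K" by (simp add: K_def)
  \<comment> \<open>With this \<open>K\<close> the union bound at \<open>2 * s j\<close> is at most \<open>2 / s j\<close>.\<close>
  have "2 / \<delta> \<le> real K" unfolding K_def by linarith
  then have K\<delta>: "2 \<le> \<delta> * real K" using \<delta> by (simp add: field_simps)
  obtain s where s: "\<And>j. 2 * K + 2 < s j" "\<And>j. s j ^ 2 \<le> s (Suc j)"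
    "\<And>j. 1 - 1 / real (Suc j) \<le> Prob (s j) (jump_probs \<delta> K (s ` {..<j})) (isolated_clique K)"
    using jump_sequence[OF \<delta>, of K] by metis
  have double: "2 * s j < s (Suc j)" for j
  proof -
    have "2 * s j < s j * s j" using s(1)[of j] by simp
    also have "\<dots> \<le> s (Suc j)" using s(2)[of j] by (simp add: power2_eq_square)
    finally show ?thesis .
  qed
  have mono: "strict_mono s"
    unfolding strict_mono_Suc_iff
  proof
    fix j show "s j < s (Suc j)" using double[of j] by simp
  qed
  define p where "p = jump_probs \<delta> K (range s)"
  have p: "0 \<le> p i \<and> p i < 1" if "1 \<le> i" for i
    unfolding p_def by (rule jump_probs_bounds[OF \<delta> that])
  have gap: "2 * u < w" if u: "u < K \<or> u \<in> range s" and w: "w \<in> range s" "u < w" for u w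
  proof (cases "u < K")
    case True
    then show ?thesis using w(1) s(1) by (metis imageE less_trans linorder_not_less mult_less_mono2 add_lessD1 zero_less_numeral)
  next
    case False
    then obtain i j where ij: "u = s i" "w = s j" using u w(1) by blast
    then have "Suc i \<le> j" using w(2) mono by (simp add: strict_mono_less Suc_le_eq)
    then have "s (Suc i) \<le> w" using mono ij by (simp add: strict_mono_less_eq)
    then show ?thesis using double[of i] ij by simp
  qed
  let ?\<psi> = "isolated_clique K"
  have "\<forall>\<^sub>F n in sequentially. real K * ln 2 / ln (real n) < \<epsilon> / 2"
    using assms by real_asymp
  then have cost: "\<forall>\<^sub>F n in sequentially. (\<Prod>i=1..n. 1 - p i) > 0 \<and>
      - (ln (\<Prod>i=1..n. 1 - p i) / ln (real n)) < \<epsilon>"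
    using eventually_ge_at_top[of "s 0"]
  proof eventually_elim
    case (elim n)
    have n: "2 < n" using elim(2) s(1)[of 0] by simp
    have pos: "0 < (\<Prod>i=1..n. 1 - p i)" using p by (intro prod_pos) auto
    have "ln ((1 / 2) ^ K * real n powr (- 2 * \<delta>)) \<le> ln (\<Prod>i=1..n. 1 - p i)"
      using jump_probs_product_ge[OF \<delta> s(1,2) mono elim(2)] n pos
      by (subst ln_le_cancel_iff) (auto simp: p_def)
    moreover have "ln ((1 / 2) ^ K * real n powr (- 2 * \<delta>)) = - (real K * ln 2) - 2 * \<delta> * ln (real n)"
      using n by (simp add: ln_mult ln_realpow ln_div ln_powr)
    ultimately have "- ln (\<Prod>i=1..n. 1 - p i) \<le> real K * ln 2 + \<epsilon> / 2 * ln (real n)"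
      by (simp add: \<delta>_def)
    moreover have "real K * ln 2 < \<epsilon> / 2 * ln (real n)"
      using elim(1) n by (simp add: divide_less_eq)
    ultimately have "- ln (\<Prod>i=1..n. 1 - p i) < \<epsilon> * ln (real n)" by simp
    moreover have "0 < ln (real n)" using n by simp
    ultimately have "- ln (\<Prod>i=1..n. 1 - p i) / ln (real n) < \<epsilon>"
      by (subst pos_divide_less_eq)
    then show ?case using pos by simp
  qed
  have Prob_s: "Prob (s j) p ?\<psi> = Prob (s j) (jump_probs \<delta> K (s ` {..<j})) ?\<psi>" for j
  proof (rule Prob_cong)
    fix d assume "d < s j"
    then have "d \<in> range s \<longleftrightarrow> d \<in> s ` {..<j}"
      using strict_mono_less[OF mono] by auto
    then show "p d = jump_probs \<delta> K (s ` {..<j}) d"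
      by (simp add: p_def jump_probs_def)
  qed
  have le1: "Prob n p ?\<psi> \<le> 1" and ge0: "0 \<le> Prob n p ?\<psi>" for n by (simp_all add: Prob_def)
  have lower: "1 - 1 / real (Suc j) \<le> Prob (s j) p ?\<psi>" for j
    unfolding Prob_s by (rule s(3))
  have to_1: "(\<lambda>j. 1 - 1 / real (Suc j)) \<longlonglongrightarrow> 1" by real_asymp
  have up: "(\<lambda>j. Prob (s j) p ?\<psi>) \<longlonglongrightarrow> 1"
    by (rule tendsto_sandwich[OF _ _ to_1 tendsto_const]) (simp_all add: lower le1 del: of_nat_Suc)
  have vanish: "(\<lambda>j. 2 / real (Suc j)) \<longlonglongrightarrow> 0" by real_asymp
  have upper: "Prob (2 * s j) p ?\<psi> \<le> 2 / real (Suc j)" for j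
  proof -
    have "Prob (2 * s j) p ?\<psi> \<le> 2 / real (s j)"
      unfolding p_def using s(1)[of j] by (intro clique_unlikely[OF \<delta> K K\<delta> _ _ gap]) auto
    also have "\<dots> \<le> 2 / real (Suc j)"
    proof -
      have "Suc j \<le> s j"
      proof (induction j)
        case 0
        show ?case using s(1)[of 0] by simp
      next
        case (Suc j)
        then show ?case using double[of j] by simp
      qed
      then show ?thesis by (intro divide_left_mono) auto
    qed
    finally show ?thesis .
  qed
  have down: "(\<lambda>j. Prob (2 * s j) p ?\<psi>) \<longlonglongrightarrow> 0"
    by (rule tendsto_sandwich[OF _ _ tendsto_const vanish]) (simp_all add: ge0 upper del: of_nat_Suc)
  have "strict_mono (\<lambda>j. 2 * s j)" using mono by (simp add: strict_mono_def)
  from liminf_eq_0_of_subsequence[OF ge0 this down]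
  have "liminf (\<lambda>n. ereal (Prob n p ?\<psi>)) = 0" .
  moreover have "limsup (\<lambda>n. ereal (Prob n p ?\<psi>)) = 1"
    by (rule limsup_eq_1_of_subsequence[OF le1 mono up])
  ultimately show ?thesis
    using cost sentence_isolated_clique[of K] K p by (intro exI[of _ p] exI[of _ ?\<psi>]) (auto simp: less_imp_le)
qed

theorem theorem1:
  "(\<forall>p :: nat \<Rightarrow> real.
      (\<forall>i\<ge>1. 0 \<le> p i \<and> p i < 1) \<longrightarrow>
      (\<lambda>n. ln (\<Prod>i=1..n. 1 - p i) / ln (real n)) \<longlonglongrightarrow> 0 \<longrightarrow>
      (\<forall>\<psi>. sentence \<psi> \<longrightarrow>
         (\<lambda>n. Prob n p \<psi>) \<longlonglongrightarrow> 0 \<or> (\<lambda>n. Prob n p \<psi>) \<longlonglongrightarrow> 1))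
   \<and>
   (\<forall>\<epsilon>::real. \<epsilon> > 0 \<longrightarrow>
      (\<exists>(p :: nat \<Rightarrow> real) \<psi>.
         (\<forall>i\<ge>1. 0 \<le> p i \<and> p i \<le> 1) \<and>
         sentence \<psi> \<and>
         (\<forall>\<^sub>F n in sequentially.
            (\<Prod>i=1..n. 1 - p i) > 0 \<and>
            - (ln (\<Prod>i=1..n. 1 - p i) / ln (real n)) < \<epsilon>) \<and>
         liminf (\<lambda>n. ereal (Prob n p \<psi>)) = 0 \<and>
         limsup (\<lambda>n. ereal (Prob n p \<psi>)) = 1))"
proof (intro conjI allI impI)
  fix p :: "nat \<Rightarrow> real" and \<psi> :: formula
  assume "\<forall>i\<ge>1. 0 \<le> p i \<and> p i < 1"
    and "(\<lambda>n. ln (\<Prod>i=1..n. 1 - p i) / ln (real n)) \<longlonglongrightarrow> 0" and "sentence \<psi>"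
  then show "(\<lambda>n. Prob n p \<psi>) \<longlonglongrightarrow> 0 \<or> (\<lambda>n. Prob n p \<psi>) \<longlonglongrightarrow> 1"
    by (intro zero_one_law) auto
qed (rule oscillation)

end
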